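(* Let $E$ be a separable Banach space, $\phi$ a measurable Young integrand on $\Omega\times E$, $f:\Omega\times E\to\overline{\mathbb{R}}$ a measurable integrand, $x_0\in L_\phi(\Omega,E)$ with $I_f(x_0)$ finite, and $x^*\in L_{\phi^*}(\Omega,E^*_{\sigma^*})$. Consider the assertions: (a) $x^*$ is a Fréchet subderivative of $I_f$ at $x_0$ on $L_\phi(\Omega,E)$; (b) for every $\epsilon>0$ and every $\lambda>0$ there exists a family $(u_r)_{r>0}$ of non negative functions, integrable for $r$ small enough, with $\lim_{r\to0_+}\|u_r\|_1=0$, such that for all sufficiently small $r>0$ $$[f-\langle x^*,\cdot\rangle](x_0,\cdot,r)\ \ge\ -\epsilon\,\phi_\lambda(\cdot)-u_r .$$ Then always (b) $\Rightarrow$ (a). If in addition the measure $\mu$ is atomless, then these assertions are equivalent.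
   Context: $(\Omega,\mathbb{T},\mu)$ is a measure space with $\mu$ a $\sigma$-finite positive measure and $\mathbb{T}$ $\mu$-complete. A measurable integrand is a $\mathbb{T}\otimes\mathcal{B}(E)$-measurable function $\Omega\times E\to\overline{\mathbb{R}}$. $I_f(x)=\int^*_\Omega f(\omega,x(\omega))\,d\mu(\omega)$ with $\int^*_\Omega v\,d\mu=\inf\{\int_\Omega u\,d\mu: u\in L_1(\Omega,\mathbb{R}),\ u\ge v\text{ a.e.}\}$. A Young function is a convex even function $E\to\overline{\mathbb{R}}_+$, continuous at $0$, vanishing at $0$, and tending to $+\infty$ as $\|e\|\to\infty$. A Young integrand is $\phi:\Omega\times E\to\overline{\mathbb{R}}_+$ with $\phi(\omega,\cdot)$ a Young function for every $\omega$; $\phi_\lambda(\omega,e)=\phi(\omega,\lambda e)$; $\phi^*(\omega,e^* )=\sup_{e\in E}(\langle e^*,e\rangle-\phi(\omega,e))$. $L_\phi(\Omega,E)$ is the set of classes of measurable $x:\Omega\to E$ such that $x\in t\{I_\phi\le1\}$ for some $t>0$, normed by $\|x\|_\phi=\inf\{t>0: x\in t\{I_\phi\le1\}\}$. $L_{\phi^*}(\Omega,E^*_{\sigma^*})$ is the analogous space of classes of scalarly measurable functions $x^*:\Omega\to E^*$, those with $I_{\phi^*}(t^{-1}x^* )\le1$ for some $t>0$; such $x^*$ acts on $L_\phi(\Omega,E)$ by $\langle x^*,x\rangle=\int_\Omega\langle x^*(\omega),x(\omega)\rangle\,d\mu$. $[f-\langle x^*,\cdot\rangle](x_0,\cdot,r)$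 is the integrand $(\omega,e)\mapsto r^{-1}(f(\omega,x_0(\omega)+re)-f(\omega,x_0(\omega)))-\langle x^*(\omega),e\rangle$. For integrands, $g\ge h$ means that there is a negligible set $N$ with $g(\omega,e)\ge h(\omega,e)$ for all $\omega\notin N$, $e\in E$. For a functional $J$ on a normed space finite at $x_0$, $x^*$ is a Fréchet subderivative of $J$ at $x_0$ if $\liminf_{x\to x_0}\frac{J(x)-J(x_0)-\langle x^*,x-x_0\rangle}{\|x-x_0\|}\ge0$. *)

theory Defs
  imports "HOL-Analysis.Analysis"
begin

text \<open>
  Integrands are curried functions \<open>'w \<Rightarrow> 'e \<Rightarrow> ereal\<close>.  The dual \<open>E\<^sup>*\<close> is the library type
  \<open>'e \<Rightarrow>\<^sub>L real\<close> of bounded linear functionals.  Elements of \<open>L\<^sub>\<phi>\<close> and \<open>L\<^sub>\<phi>\<^sub>*\<close> are represented by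
  functions; everything below depends only on their classes modulo equality almost everywhere.
\<close>

definition measurable_integrand :: "'w measure \<Rightarrow> ('w \<Rightarrow> 'e::topological_space \<Rightarrow> ereal) \<Rightarrow> bool" where
  "measurable_integrand M f \<longleftrightarrow> (\<lambda>(w, e). f w e) \<in> borel_measurable (M \<Otimes>\<^sub>M borel)"

text \<open>The infimum is \<open>\<infinity>\<close> when \<open>v\<close> has no integrable majorant.\<close>

definition upper_integral :: "'w measure \<Rightarrow> ('w \<Rightarrow> ereal) \<Rightarrow> ereal" where
  "upper_integral M v =
     (INF u \<in> {u :: 'w \<Rightarrow> real. integrable M u \<and> (AE w in M. v w \<le> ereal (u w))}.
        ereal (\<integral>w. u w \<partial>M))"

definition int_functional :: "'w measure \<Rightarrow> ('w \<Rightarrow> 'e \<Rightarrow> ereal) \<Rightarrow> ('w \<Rightarrow> 'e) \<Rightarrow> ereal" where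
  "int_functional M f x = upper_integral M (\<lambda>w. f w (x w))"

definition young_function :: "('e::real_normed_vector \<Rightarrow> ereal) \<Rightarrow> bool" where
  "young_function h \<longleftrightarrow>
     (\<forall>e. 0 \<le> h e) \<and>
     (\<forall>x y. \<forall>a\<ge>0. \<forall>b\<ge>0. a + b = 1 \<longrightarrow>
        h (a *\<^sub>R x + b *\<^sub>R y) \<le> ereal a * h x + ereal b * h y) \<and>
     (\<forall>e. h (- e) = h e) \<and>
     isCont h 0 \<and> h 0 = 0 \<and>
     (h \<longlongrightarrow> \<infinity>) at_infinity"

definition young_integrand :: "'w measure \<Rightarrow> ('w \<Rightarrow> 'e::real_normed_vector \<Rightarrow> ereal) \<Rightarrow> bool" where
  "young_integrand M \<phi> \<longleftrightarrow> (\<forall>w\<in>space M. young_function (\<phi> w))"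

definition scaled_integrand :: "('w \<Rightarrow> 'e::real_vector \<Rightarrow> ereal) \<Rightarrow> real \<Rightarrow> 'w \<Rightarrow> 'e \<Rightarrow> ereal" where
  "scaled_integrand \<phi> l w e = \<phi> w (l *\<^sub>R e)"

definition conjugate_integrand ::
  "('w \<Rightarrow> 'e::real_normed_vector \<Rightarrow> ereal) \<Rightarrow> 'w \<Rightarrow> ('e \<Rightarrow>\<^sub>L real) \<Rightarrow> ereal" where
  "conjugate_integrand \<phi> w e' = (SUP e. ereal (blinfun_apply e' e) - \<phi> w e)"

definition orlicz_space ::
  "'w measure \<Rightarrow> ('w \<Rightarrow> 'e::real_normed_vector \<Rightarrow> ereal) \<Rightarrow> ('w \<Rightarrow> 'e) set" where
  "orlicz_space M \<phi> =
     {x \<in> borel_measurable M. \<exists>t>0. int_functional M \<phi> (\<lambda>w. inverse t *\<^sub>R x w) \<le> 1}"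

definition orlicz_norm ::
  "'w measure \<Rightarrow> ('w \<Rightarrow> 'e::real_normed_vector \<Rightarrow> ereal) \<Rightarrow> ('w \<Rightarrow> 'e) \<Rightarrow> real" where
  "orlicz_norm M \<phi> x =
     Inf {t. 0 < t \<and> int_functional M \<phi> (\<lambda>w. inverse t *\<^sub>R x w) \<le> 1}"

definition scalarly_measurable ::
  "'w measure \<Rightarrow> ('w \<Rightarrow> ('e::real_normed_vector \<Rightarrow>\<^sub>L real)) \<Rightarrow> bool" where
  "scalarly_measurable M x' \<longleftrightarrow> (\<forall>e. (\<lambda>w. blinfun_apply (x' w) e) \<in> borel_measurable M)"

text \<open>The space \<open>L\<^sub>\<phi>\<^sub>*(\<Omega>, E\<^sup>*)\<close>; the argument is \<open>\<phi>\<close>, not its conjugate.\<close>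

definition dual_orlicz_space ::
  "'w measure \<Rightarrow> ('w \<Rightarrow> 'e::real_normed_vector \<Rightarrow> ereal) \<Rightarrow> ('w \<Rightarrow> ('e \<Rightarrow>\<^sub>L real)) set" where
  "dual_orlicz_space M \<phi> =
     {x'. scalarly_measurable M x' \<and>
        (\<exists>t>0. int_functional M (conjugate_integrand \<phi>) (\<lambda>w. inverse t *\<^sub>R x' w) \<le> 1)}"

definition pairing ::
  "'w measure \<Rightarrow> ('w \<Rightarrow> ('e::real_normed_vector \<Rightarrow>\<^sub>L real)) \<Rightarrow> ('w \<Rightarrow> 'e) \<Rightarrow> real" where
  "pairing M x' x = (\<integral>w. blinfun_apply (x' w) (x w) \<partial>M)"

text \<open>
  Punctured neighbourhoods of \<open>x0\<close> in the normed space \<open>L\<^sub>\<phi>\<close>.  Removing the point \<open>x0\<close> means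
  removing its whole class.
\<close>

definition orlicz_at ::
  "'w measure \<Rightarrow> ('w \<Rightarrow> 'e::real_normed_vector \<Rightarrow> ereal) \<Rightarrow> ('w \<Rightarrow> 'e) \<Rightarrow> ('w \<Rightarrow> 'e) filter" where
  "orlicz_at M \<phi> x0 =
     (INF d\<in>{0<..}. principal
        {x \<in> orlicz_space M \<phi>. \<not> (AE w in M. x w = x0 w) \<and>
           orlicz_norm M \<phi> (\<lambda>w. x w - x0 w) < d})"

definition frechet_subderivative ::
  "'w measure \<Rightarrow> ('w \<Rightarrow> 'e::real_normed_vector \<Rightarrow> ereal) \<Rightarrow> (('w \<Rightarrow> 'e) \<Rightarrow> ereal) \<Rightarrow>
   ('w \<Rightarrow> ('e \<Rightarrow>\<^sub>L real)) \<Rightarrow> ('w \<Rightarrow> 'e) \<Rightarrow> bool" where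
  "frechet_subderivative M \<phi> J x' x0 \<longleftrightarrow>
     \<bar>J x0\<bar> \<noteq> \<infinity> \<and>
     0 \<le> Liminf (orlicz_at M \<phi> x0)
           (\<lambda>x. (J x - J x0 - ereal (pairing M x' (\<lambda>w. x w - x0 w))) /
                ereal (orlicz_norm M \<phi> (\<lambda>w. x w - x0 w)))"

text \<open>
  The integrand \<open>[f - \<langle>x', \<cdot>\<rangle>](x0, \<cdot>, r)\<close>.  When \<open>I\<^sub>f(x0)\<close> is finite, \<open>f w (x0 w)\<close> is finite for almost
  every \<open>w\<close>, so the value of \<open>\<infinity> - \<infinity>\<close> is irrelevant.
\<close>

definition diff_quotient_integrand ::
  "('w \<Rightarrow> 'e::real_normed_vector \<Rightarrow> ereal) \<Rightarrow> ('w \<Rightarrow> ('e \<Rightarrow>\<^sub>L real)) \<Rightarrow> ('w \<Rightarrow> 'e) \<Rightarrow> real \<Rightarrow>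
   'w \<Rightarrow> 'e \<Rightarrow> ereal" where
  "diff_quotient_integrand f x' x0 r w e =
     ereal (inverse r) * (f w (x0 w + r *\<^sub>R e) - f w (x0 w)) - ereal (blinfun_apply (x' w) e)"

text \<open>One negligible set serves for all \<open>e\<close>.\<close>

definition integrand_ge ::
  "'w measure \<Rightarrow> ('w \<Rightarrow> 'e \<Rightarrow> ereal) \<Rightarrow> ('w \<Rightarrow> 'e \<Rightarrow> ereal) \<Rightarrow> bool" where
  "integrand_ge M g h \<longleftrightarrow> (AE w in M. \<forall>e. g w e \<ge> h w e)"

text \<open>
  For a \<open>\<sigma>\<close>-finite measure, requiring \<open>emeasure M B < emeasure M A\<close> excludes exactly the usual atoms:
  a set of infinite measure contains measurable sets of positive finite measure.
\<close>

definition atomless :: "'w measure \<Rightarrow> bool" where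
  "atomless M \<longleftrightarrow>
     (\<forall>A\<in>sets M. 0 < emeasure M A \<longrightarrow>
        (\<exists>B\<in>sets M. B \<subseteq> A \<and> 0 < emeasure M B \<and> emeasure M B < emeasure M A))"

definition frechet_minorant_condition ::
  "'w measure \<Rightarrow> ('w \<Rightarrow> 'e::real_normed_vector \<Rightarrow> ereal) \<Rightarrow> ('w \<Rightarrow> 'e \<Rightarrow> ereal) \<Rightarrow>
   ('w \<Rightarrow> ('e \<Rightarrow>\<^sub>L real)) \<Rightarrow> ('w \<Rightarrow> 'e) \<Rightarrow> bool" where
  "frechet_minorant_condition M \<phi> f x' x0 \<longleftrightarrow>
     (\<forall>\<epsilon>>0. \<forall>l>0. \<exists>u :: real \<Rightarrow> 'w \<Rightarrow> real.
        (\<forall>r>0. \<forall>w\<in>space M. 0 \<le> u r w) \<and>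
        (\<forall>\<^sub>F r in at_right 0. integrable M (u r)) \<and>
        ((\<lambda>r. \<integral>w. \<bar>u r w\<bar> \<partial>M) \<longlongrightarrow> 0) (at_right 0) \<and>
        (\<forall>\<^sub>F r in at_right 0.
           integrand_ge M (diff_quotient_integrand f x' x0 r)
             (\<lambda>w e. - (ereal \<epsilon> * scaled_integrand \<phi> l w e) - ereal (u r w))))"

end

theory Submission
  imports Defs
begin

text \<open>
  Write \<open>g = - ([f - x'](x0, \<cdot>, r) + \<epsilon> \<phi>\<^sub>\<lambda>)\<close>; the minorant condition asks for an integrable bound \<open>u\<^sub>r\<close> of
  \<open>g\<close>, uniform in \<open>e\<close>, whose \<open>L\<^sub>1\<close> norm vanishes as \<open>r\<close> tends to \<open>0\<close>.

  From the minorant to the subderivative: insert \<open>e = (x - x0) / r\<close> with \<open>r\<close> twice the norm of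
  \<open>x - x0\<close>, multiply by \<open>r\<close> and integrate.  The modular of \<open>e\<close> is at most \<open>1\<close>, so the loss is at most
  \<open>r (\<epsilon> + \<parallel>u\<^sub>r\<parallel>)\<close>, a small multiple of the norm (\<open>frechet_subderivative_if_minorant\<close>).

  From the subderivative to the minorant, for an atomless measure: the least possible \<open>u\<^sub>r\<close> is
  \<open>U\<^sub>r w = max 0 (SUP e. g w e)\<close>, and the task is to show that its integral tends to \<open>0\<close>.  Let \<open>e\<close> be a
  measurable function with \<open>g w (e w) \<ge> k w \<ge> 0\<close> almost everywhere, where \<open>k\<close> is integrable.  If the
  modular of \<open>\<lambda> e\<close> is at most \<open>1\<close>, then \<open>r e\<close> has norm at most \<open>r / \<lambda>\<close>, and the subderivative
  inequality with error \<open>\<eta>\<close> at \<open>x0 + r e\<close> says that the integral of \<open>k\<close> plus \<open>\<epsilon>\<close> times the modular is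
  at most \<open>\<eta> / \<lambda>\<close> (\<open>gap_estimate_modular_le_1\<close>).  If the modular were larger than \<open>1\<close>, then, since there
  are no atoms, \<open>e\<close> could be cut off to a set on which the modular lies between \<open>1/2\<close> and \<open>1\<close>
  (\<open>atomless_nn_integral_between\<close>); as \<open>g\<close> vanishes at \<open>e = 0\<close> the cut-off function is still
  admissible, and \<open>\<epsilon> / 2 \<le> \<eta> / \<lambda>\<close> follows, which is false for small \<open>\<eta>\<close>.  Hence the integral of \<open>k\<close> is
  always at most \<open>\<eta> / \<lambda>\<close> (\<open>gap_estimate\<close>).  Functions \<open>e\<close> that nearly realise the supremum \<open>U\<^sub>r\<close> exist
  by measurable selection, so the integral of \<open>U\<^sub>r\<close> is at most \<open>\<eta> / \<lambda>\<close> as well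
  (\<open>nn_integral_excess_le\<close>).

  The analytic core of the second half is therefore the selection theorem of Aumann and von Neumann
  (\<open>measurable_selection\<close>): over a complete \<open>\<sigma>\<close>-finite measure space, the projection to \<open>\<Omega>\<close> of a
  product measurable set in \<open>\<Omega> \<times> E\<close> is measurable, and the set has a measurable selection almost
  everywhere.  The proof writes product measurable sets as results of the Suslin operation on measurable
  sets and uses the capacity argument of Choquet; the points of \<open>E\<close> are coded by sequences of integers.
\<close>

section \<open>Suslin operations on measurable sets\<close>

text \<open>
  Continuity for the discrete topology on the target and the product topology on sequences.
\<close>

definition finitely_determined :: "((nat \<Rightarrow> nat) \<Rightarrow> 'b) \<Rightarrow> bool" where
  "finitely_determined q \<longleftrightarrow> (\<forall>\<sigma>. \<exists>F. finite F \<and> (\<forall>\<tau>. (\<forall>i\<in>F. \<tau> i = \<sigma> i) \<longrightarrow> q \<tau> = q \<sigma>))"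

lemma finitely_determinedE:
  assumes "finitely_determined q"
  obtains n where "\<And>\<tau>. (\<And>i. i < n \<Longrightarrow> \<tau> i = \<sigma> i) \<Longrightarrow> q \<tau> = q \<sigma>"
proof -
  obtain F where F: "finite F" "\<And>\<tau>. (\<forall>i\<in>F. \<tau> i = \<sigma> i) \<longrightarrow> q \<tau> = q \<sigma>"
    using assms unfolding finitely_determined_def by blast
  obtain n where "\<forall>i\<in>F. i < n"
    using F(1) finite_nat_set_iff_bounded by blast
  then show ?thesis using F(2) by (intro that[of n]) blast
qed

text \<open>
  The result of the Suslin operation: \<open>P m \<zeta>\<close> is the \<open>m\<close>-th requirement along the branch \<open>\<zeta>\<close>, and a
  point belongs to the result if it meets all requirements along some branch.
\<close>

definition suslin :: "'w set \<Rightarrow> (nat \<Rightarrow> (nat \<Rightarrow> nat) \<Rightarrow> 'w set) \<Rightarrow> 'w set" where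
  "suslin \<Omega> P = {w\<in>\<Omega>. \<exists>\<zeta>. \<forall>m. w \<in> P m \<zeta>}"

definition cylinder :: "nat list \<Rightarrow> (nat \<Rightarrow> nat) set" where
  "cylinder s = {\<zeta>. \<forall>i<length s. \<zeta> i = s ! i}"

lemma cylinder_take: "cylinder s \<subseteq> cylinder (take n s)"
  by (auto simp: cylinder_def)

lemma in_cylinder_map: "\<zeta> \<in> cylinder (map \<zeta> [0..<n])"
  by (auto simp: cylinder_def)

text \<open>
  The tree of outer approximations: a point survives at the node \<open>s\<close> if it meets those early
  requirements that already have a definite value \<open>X\<close> on all branches through \<open>s\<close>.
\<close>

definition decided :: "'w set \<Rightarrow> (nat \<Rightarrow> (nat \<Rightarrow> nat) \<Rightarrow> 'w set) \<Rightarrow> nat list \<Rightarrow> 'w set" where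
  "decided \<Omega> P s = {w\<in>\<Omega>. \<forall>m<length s. \<forall>X. (\<forall>\<zeta>\<in>cylinder s. P m \<zeta> = X) \<longrightarrow> w \<in> X}"

lemma decided_take: "decided \<Omega> P s \<subseteq> decided \<Omega> P (take n s)"
  proof
  fix w assume w: "w \<in> decided \<Omega> P s"
  have "w \<in> X" if m: "m < length (take n s)" and X: "\<forall>\<zeta>\<in>cylinder (take n s). P m \<zeta> = X" for m X
  proof -
    have "\<forall>\<zeta>\<in>cylinder s. P m \<zeta> = X" using X cylinder_take[of s n] by auto
    moreover have "m < length s" using m by simp
    ultimately show ?thesis using w unfolding decided_def by blast
  qed
  then show "w \<in> decided \<Omega> P (take n s)" using w by (simp add: decided_def)
qed

lemma cylinder_nonempty: "(\<lambda>i. if i < length s then s ! i else 0) \<in> cylinder s"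
  by (auto simp: cylinder_def)

lemma sets_decided:
  assumes "\<And>m \<zeta>. P m \<zeta> \<in> sets M"
  shows "decided (space M) P s \<in> sets M"
proof -
  have "{w\<in>space M. \<forall>X. (\<forall>\<zeta>\<in>cylinder s. P m \<zeta> = X) \<longrightarrow> w \<in> X} \<in> sets M" for m
  proof (cases "\<exists>X. \<forall>\<zeta>\<in>cylinder s. P m \<zeta> = X")
    case True
    then obtain X where X: "\<forall>\<zeta>\<in>cylinder s. P m \<zeta> = X" by blast
    have "X \<in> sets M" using X cylinder_nonempty[of s] assms by metis
    moreover have "{w\<in>space M. \<forall>Y. (\<forall>\<zeta>\<in>cylinder s. P m \<zeta> = Y) \<longrightarrow> w \<in> Y} = {w\<in>space M. w \<in> X}"
      using X cylinder_nonempty[of s] by auto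
    ultimately show ?thesis by simp
  next
    case False
    then have "{w\<in>space M. \<forall>X. (\<forall>\<zeta>\<in>cylinder s. P m \<zeta> = X) \<longrightarrow> w \<in> X} = space M"
      by auto
    then show ?thesis by simp
  qed
  note D = this
  have "{w\<in>space M. \<forall>m. m < length s \<longrightarrow> (\<forall>X. (\<forall>\<zeta>\<in>cylinder s. P m \<zeta> = X) \<longrightarrow> w \<in> X)} \<in> sets M"
    by (rule sets.sets_Collect_countable_All, rule sets.sets_Collect_imp, rule D, rule sets.sets_Collect_const)
  then show ?thesis unfolding decided_def .
qed

text \<open>
  Nothing is lost by looking at prefixes only, because every requirement is decided by a sufficiently
  long prefix of the branch.
\<close>

lemma decided_branch:
  assumes "\<And>m. finitely_determined (P m)" "\<And>n. w \<in> decided \<Omega> P (map \<zeta> [0..<n])"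
  shows "w \<in> P m \<zeta>"
proof -
  obtain n where n: "\<And>\<tau>. (\<And>i. i < n \<Longrightarrow> \<tau> i = \<zeta> i) \<Longrightarrow> P m \<tau> = P m \<zeta>"
    using finitely_determinedE[OF assms(1)] by metis
  define k where "k = max n (Suc m)"
  have "w \<in> decided \<Omega> P (map \<zeta> [0..<k])" by fact
  moreover have "m < length (map \<zeta> [0..<k])" by (simp add: k_def)
  moreover have "\<forall>\<tau>\<in>cylinder (map \<zeta> [0..<k]). P m \<tau> = P m \<zeta>"
    by (auto simp: cylinder_def k_def intro!: n)
  ultimately show ?thesis unfolding decided_def by blast
qed

lemma decided_contains:
  assumes "w \<in> \<Omega>" "\<And>m. w \<in> P m \<zeta>"
  shows "w \<in> decided \<Omega> P (map \<zeta> [0..<n])"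
  using assms in_cylinder_map[of \<zeta> n] unfolding decided_def by auto

text \<open>
  Bounds and branches are constructed below one entry at a time, as nested lists; they are the initial
  segments of one sequence.
\<close>

lemma list_recursion_limit:
  assumes "s 0 = []" "\<And>n. \<exists>x. s (Suc n) = s n @ [x]"
  shows "s n = map (\<lambda>i. s (Suc i) ! i) [0..<n]" "length (s n) = n"
proof -
  show len: "length (s n) = n" for n
  proof (induction n)
    case (Suc n) then show ?case using assms(2)[of n] by auto
  qed (use assms in simp)
  show "s n = map (\<lambda>i. s (Suc i) ! i) [0..<n]"
  proof (induction n)
    case (Suc n)
    obtain x where "s (Suc n) = s n @ [x]" using assms(2) by blast
    moreover have "s (Suc n) ! n = x" using calculation len[of n] by (simp add: nth_append)
    ultimately show ?case using Suc by simp
  qed (use assms in simp)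
qed

definition bounded_by :: "(nat \<Rightarrow> nat) \<Rightarrow> nat list \<Rightarrow> bool" where
  "bounded_by b t \<longleftrightarrow> (\<forall>i<length t. t ! i \<le> b i)"

text \<open>
  The nodes at which a point has surviving descendants of every length, with entries bounded by \<open>b\<close>.
\<close>

definition extendable :: "'w set \<Rightarrow> (nat \<Rightarrow> (nat \<Rightarrow> nat) \<Rightarrow> 'w set) \<Rightarrow> (nat \<Rightarrow> nat) \<Rightarrow> nat list \<Rightarrow> 'w set" where
  "extendable \<Omega> P b s = {w\<in>\<Omega>. \<forall>n\<ge>length s. \<exists>t. length t = n \<and> take (length s) t = s \<and>
      bounded_by b t \<and> w \<in> decided \<Omega> P t}"

lemma sets_extendable:
  assumes "\<And>m \<zeta>. P m \<zeta> \<in> sets M"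
  shows "extendable (space M) P b s \<in> sets M"
proof -
  have [measurable]: "Measurable.pred M (\<lambda>w. w \<in> decided (space M) P t)" for t
    using sets_decided[OF assms, where s=t] by (simp add: pred_def)
  show ?thesis unfolding extendable_def by measurable
qed

lemma extendable_decided: "w \<in> extendable \<Omega> P b s \<Longrightarrow> w \<in> decided \<Omega> P s"
  unfolding extendable_def by force

text \<open>
  Koenig's lemma.  Only finitely many values \<open>j \<le> b (length s)\<close> are allowed for the next entry; if each
  of the corresponding nodes had no descendant of some length \<open>N j\<close>, then \<open>s\<close> would have none of length
  \<open>max\<^sub>j (N j)\<close>.
\<close>

lemma extendable_step:
  assumes "w \<in> extendable \<Omega> P b s"
  shows "\<exists>j. w \<in> extendable \<Omega> P b (s @ [j])"
proof (rule ccontr)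
  assume neg: "\<nexists>j. w \<in> extendable \<Omega> P b (s @ [j])"
  have w: "w \<in> \<Omega>" using assms by (auto simp: extendable_def)
  have "\<forall>j. \<exists>n\<ge>Suc (length s). \<nexists>t. length t = n \<and> take (Suc (length s)) t = s @ [j] \<and>
      bounded_by b t \<and> w \<in> decided \<Omega> P t"
    using neg w by (simp add: extendable_def)
  then obtain N where N: "\<And>j. N j \<ge> Suc (length s)"
     "\<And>j t. length t = N j \<Longrightarrow> take (Suc (length s)) t = s @ [j] \<Longrightarrow>
      bounded_by b t \<Longrightarrow> w \<notin> decided \<Omega> P t" by metis
  define n where "n = Max (N ` {..b (length s)})"
  have n: "N j \<le> n" if "j \<le> b (length s)" for j
    using that unfolding n_def by (intro Max_ge) auto
  have "Suc (length s) \<le> n" using N(1)[of 0] n[of 0] by simp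
  then have "length s \<le> n" by simp
  with assms have extends: "\<exists>t. length t = n \<and> take (length s) t = s \<and> bounded_by b t \<and> w \<in> decided \<Omega> P t"
    unfolding extendable_def by blast
  obtain t where t: "length t = n" "take (length s) t = s" "bounded_by b t" "w \<in> decided \<Omega> P t"
    using that extends by blast
  define j where "j = t ! length s"
  have "j \<le> b (length s)" using t(1,3) \<open>Suc (length s) \<le> n\<close> by (auto simp: bounded_by_def j_def)
  then have jn: "N j \<le> n" by (rule n)
  have "take (Suc (length s)) (take (N j) t) = s @ [j]"
    using N(1)[of j] t(1,2) \<open>Suc (length s) \<le> n\<close> by (simp add: min_def take_Suc_conv_app_nth j_def)
  moreover have "bounded_by b (take (N j) t)" using t(3) by (simp add: bounded_by_def)
  moreover have "w \<in> decided \<Omega> P (take (N j) t)" using decided_take[THEN subsetD, OF t(4)] .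
  moreover have "length (take (N j) t) = N j" using jn t(1) by simp
  ultimately show False using N(2) by blast
qed

text \<open>
  Following the least surviving child at every node gives a branch that depends measurably on the point:
  each initial segment takes values in the countable set of lists.
\<close>

lemma measurable_leftmost_branch:
  fixes L :: "nat list \<Rightarrow> 'w set"
  assumes L: "\<And>s. L s \<in> sets M" and step: "\<And>s w. w \<in> L s \<Longrightarrow> \<exists>j. w \<in> L (s @ [j])"
  obtains z :: "'w \<Rightarrow> nat \<Rightarrow> nat" where
    "\<And>i. (\<lambda>w. z w i) \<in> measurable M (count_space UNIV)"
    "\<And>w n. w \<in> L [] \<Longrightarrow> w \<in> L (map (z w) [0..<n])"
proof -
  define p where "p w n = rec_nat [] (\<lambda>_ s. s @ [LEAST j. w \<in> L (s @ [j])]) n" for w n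
  have p0: "p w 0 = []" and pS: "p w (Suc n) = p w n @ [LEAST j. w \<in> L (p w n @ [j])]" for w n
    by (simp_all add: p_def)
  define z where "z w i = p w (Suc i) ! i" for w i
  have pz: "p w n = map (z w) [0..<n]" for w n
    unfolding z_def by (rule list_recursion_limit(1)) (auto simp: p0 pS)
  have "p w n \<in> {s. w \<in> L s}" if "w \<in> L []" for w n
  proof (induction n)
    case (Suc n)
    then have "\<exists>j. w \<in> L (p w n @ [j])" using step by auto
    then have "w \<in> L (p w n @ [LEAST j. w \<in> L (p w n @ [j])])" by (rule LeastI_ex)
    then show ?case by (simp add: pS)
  qed (use that p0 in simp)
  then have 2: "w \<in> L (map (z w) [0..<n])" if "w \<in> L []" for w n
    using that by (metis mem_Collect_eq pz)
  have pm: "(\<lambda>w. p w n) \<in> measurable M (count_space UNIV)" for n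
  proof (induction n)
    case (Suc n)
    have least: "(\<lambda>w. LEAST j. w \<in> L (s @ [j])) \<in> measurable M (count_space UNIV)" for s
    proof (rule measurable_Least)
      fix j
      have "{w\<in>space M. w \<in> L (s @ [j])} \<in> sets M" using L[of "s @ [j]"] by simp
      then show "Measurable.pred M (\<lambda>w. w \<in> L (s @ [j]))" by (simp add: pred_def)
    qed
    have "(\<lambda>w. s @ [LEAST j. w \<in> L (s @ [j])]) \<in> measurable M (count_space UNIV)" for s
      by (rule measurable_compose[OF least]) simp
    then have "(\<lambda>w. p w n @ [LEAST j. w \<in> L (p w n @ [j])]) \<in> measurable M (count_space UNIV)"
      by (rule measurable_compose_countable[OF _ Suc])
    then show ?case by (simp add: pS)
  qed (simp add: p0)
  have "(\<lambda>w. z w i) \<in> measurable M (count_space UNIV)" for i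
    unfolding z_def by (rule measurable_compose[OF pm]) simp
  with 2 show ?thesis using that by blast
qed

text \<open>
  Outer measure is continuous along increasing unions, and bounding one more coordinate by
  \<open>j = 0, 1, 2, \<dots>\<close> exhausts the set obtained so far.  So the coordinates can be bounded one after the
  other without the outer measure ever dropping to \<open>c\<close>.
\<close>

lemma capacity_bounds:
  fixes M :: "'w measure"
  assumes c: "c < outer_measure_of M (suslin (space M) P)"
  obtains b where "\<And>n. c < outer_measure_of M {w\<in>space M. \<exists>\<zeta>. (\<forall>i<n. \<zeta> i \<le> b i) \<and> (\<forall>m. w \<in> P m \<zeta>)}"
proof -
  define D where "D bs = {w\<in>space M. \<exists>\<zeta>. (\<forall>i<length bs. \<zeta> i \<le> bs ! i) \<and> (\<forall>m. w \<in> P m \<zeta>)}" for bs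
  have step: "\<exists>bs'. c < outer_measure_of M (D bs') \<and> (\<exists>j. bs' = bs @ [j])"
    if "c < outer_measure_of M (D bs)" for bs
  proof -
    have inc: "incseq (\<lambda>j. D (bs @ [j]))"
    proof (intro monoI subsetI)
      fix j k w assume "j \<le> k" "w \<in> D (bs @ [j])"
      then obtain \<zeta> where z: "w \<in> space M" "\<forall>m. w \<in> P m \<zeta>" "\<forall>i<Suc (length bs). \<zeta> i \<le> (bs @ [j]) ! i"
        by (auto simp: D_def)
      then have "\<forall>i<Suc (length bs). \<zeta> i \<le> (bs @ [k]) ! i"
        using \<open>j \<le> k\<close> by (auto simp: nth_append less_Suc_eq split: if_splits)
      with z show "w \<in> D (bs @ [k])" by (auto simp: D_def)
    qed
    have "D bs = (\<Union>j. D (bs @ [j]))"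
    proof (intro subset_antisym subsetI)
      fix w assume "w \<in> D bs"
      then obtain \<zeta> where z: "w \<in> space M" "\<forall>m. w \<in> P m \<zeta>" "\<forall>i<length bs. \<zeta> i \<le> bs ! i"
        by (auto simp: D_def)
      then have "w \<in> D (bs @ [\<zeta> (length bs)])"
        by (auto simp: D_def nth_append less_Suc_eq intro!: exI[of _ \<zeta>])
      then show "w \<in> (\<Union>j. D (bs @ [j]))" by blast
    next
      fix w assume "w \<in> (\<Union>j. D (bs @ [j]))"
      then obtain j where "w \<in> D (bs @ [j])" by blast
      then obtain \<zeta> where z: "w \<in> space M" "\<forall>m. w \<in> P m \<zeta>" "\<forall>i<Suc (length bs). \<zeta> i \<le> (bs @ [j]) ! i"
        by (auto simp: D_def)
      have "\<forall>i<length bs. \<zeta> i \<le> bs ! i" using z(3) by (metis less_SucI nth_append)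
      with z show "w \<in> D bs" by (auto simp: D_def)
    qed
    moreover have "(SUP j. outer_measure_of M (D (bs @ [j]))) = outer_measure_of M (\<Union>j. D (bs @ [j]))"
      by (rule SUP_outer_measure_of_incseq[OF _ inc]) (auto simp: D_def)
    ultimately have "c < (SUP j. outer_measure_of M (D (bs @ [j])))" using that by simp
    then obtain j where "c < outer_measure_of M (D (bs @ [j]))" by (auto simp: less_SUP_iff)
    then show ?thesis by blast
  qed
  have "\<exists>f. \<forall>n. (c < outer_measure_of M (D (f n)) \<and> (n = 0 \<longrightarrow> f n = [])) \<and> (\<exists>j. f (Suc n) = f n @ [j])"
  proof (rule dependent_nat_choice)
    show "\<exists>bs. c < outer_measure_of M (D bs) \<and> ((0::nat) = 0 \<longrightarrow> bs = [])"
      using c by (auto simp: D_def suslin_def)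
    fix bs and n :: nat assume "c < outer_measure_of M (D bs) \<and> (n = 0 \<longrightarrow> bs = [])"
    then show "\<exists>y. (c < outer_measure_of M (D y) \<and> (Suc n = 0 \<longrightarrow> y = [])) \<and> (\<exists>j. y = bs @ [j])"
      using step[of bs] by auto
  qed
  then obtain f where f: "\<And>n. c < outer_measure_of M (D (f n))" "f 0 = []" "\<And>n. \<exists>j. f (Suc n) = f n @ [j]"
    by metis
  define b where "b i = f (Suc i) ! i" for i
  have "f n = map b [0..<n]" for n unfolding b_def by (rule list_recursion_limit(1)[OF f(2,3)])
  then have "c < outer_measure_of M (D (map b [0..<n]))" for n using f(1)[of n] by simp
  then show ?thesis by (intro that[of b]) (simp add: D_def)
qed

text \<open>
  Choquet's capacity argument.  With the bounds \<open>b\<close> at hand, the points surviving at some bounded node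
  of length \<open>n\<close> form a decreasing sequence of measurable sets of measure more than \<open>c\<close>.  By Koenig's
  lemma the points in the intersection survive along an infinite branch, hence lie in the Suslin set, and
  the leftmost such branch is a measurable selection.
\<close>

lemma suslin_inner_selection:
  fixes M :: "'w measure"
  assumes "finite_measure M"
    and P: "\<And>m \<zeta>. P m \<zeta> \<in> sets M" "\<And>m. finitely_determined (P m)"
    and c: "c < outer_measure_of M (suslin (space M) P)"
  obtains K z where "K \<in> sets M" "c \<le> emeasure M K"
    "\<And>i. (\<lambda>w. z w i) \<in> measurable M (count_space UNIV)"
    "\<And>w m. w \<in> K \<Longrightarrow> w \<in> P m (z w)"
proof -
  interpret finite_measure M by fact
  obtain b where b: "\<And>n. c < outer_measure_of M {w\<in>space M. \<exists>\<zeta>. (\<forall>i<n. \<zeta> i \<le> b i) \<and> (\<forall>m. w \<in> P m \<zeta>)}"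
    by (rule capacity_bounds[OF c], rule that)
  let ?L = "extendable (space M) P b"
  obtain z where z: "\<And>i. (\<lambda>w. z w i) \<in> measurable M (count_space UNIV)"
    "\<And>w n. w \<in> ?L [] \<Longrightarrow> w \<in> ?L (map (z w) [0..<n])"
    by (rule measurable_leftmost_branch[of ?L M, OF sets_extendable[OF P(1)] extendable_step], assumption, rule that)
  have sel: "w \<in> P m (z w)" if "w \<in> ?L []" for w m
    by (rule decided_branch[OF P(2) extendable_decided[OF z(2)[OF that]]])
  define K where "K n = {w\<in>space M. \<exists>t. length t = n \<and> bounded_by b t \<and> w \<in> decided (space M) P t}" for n
  have [measurable]: "Measurable.pred M (\<lambda>w. w \<in> decided (space M) P t)" for t
    using sets_decided[OF P(1), where s=t] by (simp add: pred_def)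
  have Km: "K n \<in> sets M" for n unfolding K_def by measurable
  have dec: "decseq K"
  proof (rule decseq_SucI, rule subsetI)
    fix n w assume "w \<in> K (Suc n)"
    then obtain t where t: "w \<in> space M" "length t = Suc n" "bounded_by b t" "w \<in> decided (space M) P t"
      by (auto simp: K_def)
    then have "length (take n t) = n" "bounded_by b (take n t)" "w \<in> decided (space M) P (take n t)"
      using decided_take[THEN subsetD, OF t(4)] by (auto simp: bounded_by_def)
    then show "w \<in> K n" unfolding K_def
      by (intro CollectI conjI t(1) exI[of _ "take n t"]) auto
  qed
  have "c \<le> emeasure M (K n)" for n
  proof -
    have "{w\<in>space M. \<exists>\<zeta>. (\<forall>i<n. \<zeta> i \<le> b i) \<and> (\<forall>m. w \<in> P m \<zeta>)} \<subseteq> K n"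
    proof
      fix w assume "w \<in> {w\<in>space M. \<exists>\<zeta>. (\<forall>i<n. \<zeta> i \<le> b i) \<and> (\<forall>m. w \<in> P m \<zeta>)}"
      then obtain \<zeta> where "w \<in> space M" "\<forall>i<n. \<zeta> i \<le> b i" "\<forall>m. w \<in> P m \<zeta>" by blast
      then show "w \<in> K n"
        by (auto simp: K_def bounded_by_def intro!: exI[of _ "map \<zeta> [0..<n]"] decided_contains)
    qed
    then have "outer_measure_of M {w\<in>space M. \<exists>\<zeta>. (\<forall>i<n. \<zeta> i \<le> b i) \<and> (\<forall>m. w \<in> P m \<zeta>)}
       \<le> outer_measure_of M (K n)" by (rule outer_measure_of_mono)
    with b[of n] Km[of n] show ?thesis by simp
  qed
  moreover have "(INF n. emeasure M (K n)) = emeasure M (\<Inter>n. K n)"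
    using Km dec by (intro INF_emeasure_decseq) auto
  moreover have "(\<Inter>n. K n) = ?L []"
    by (auto simp: K_def extendable_def)
  ultimately have "c \<le> emeasure M (?L [])" by (metis le_INF_iff)
  then show ?thesis by (rule that[OF sets_extendable[OF P(1)] _ z(1) sel])
qed

text \<open>
  Inner approximations \<open>K n\<close> with measure tending to the outer measure exhaust the Suslin set up to a
  null set, so completeness gives measurability.
\<close>

lemma suslin_selection_finite:
  fixes M :: "'w measure"
  assumes "finite_measure M" "complete_measure M"
    and P: "\<And>m \<zeta>. P m \<zeta> \<in> sets M" "\<And>m. finitely_determined (P m)"
  defines "D \<equiv> suslin (space M) P"
  obtains z where "D \<in> sets M" "\<And>i. (\<lambda>w. z w i) \<in> measurable M (count_space UNIV)"
    "AE w in M. w \<in> D \<longrightarrow> (\<forall>m. w \<in> P m (z w))"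
proof -
  interpret finite_measure M by fact
  interpret complete_measure M by fact
  have sub: "D \<subseteq> space M" by (auto simp: D_def suslin_def)
  obtain H where H: "H \<in> sets M" "D \<subseteq> H" "outer_measure_of M D = emeasure M H"
    using outer_measure_of_attain[OF sub] by blast
  have "\<exists>K z. K \<in> sets M \<and> emeasure M H - ennreal (1 / Suc n) \<le> emeasure M K \<and>
      (\<forall>i. (\<lambda>w. z w i) \<in> measurable M (count_space UNIV)) \<and> (\<forall>w m. w \<in> K \<longrightarrow> w \<in> P m (z w))" for n :: nat
  proof (cases "emeasure M H = 0")
    case True
    then show ?thesis by (intro exI[of _ "{}"] exI[of _ "\<lambda>_ _. 0"]) auto
  next
    case False
    have "emeasure M H \<noteq> \<infinity>" by simp
    then have lt: "emeasure M H - ennreal (1 / Suc n) < outer_measure_of M D"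
      unfolding H(3) using False
      by (intro ennreal_between) (auto simp: zero_less_iff_neq_zero less_top[symmetric]) 
    obtain K z where Kz: "K \<in> sets M" "emeasure M H - ennreal (1 / Suc n) \<le> emeasure M K"
      "\<And>i. (\<lambda>w. z w i) \<in> measurable M (count_space UNIV)" "\<And>w m. w \<in> K \<Longrightarrow> w \<in> P m (z w)"
      by (rule suslin_inner_selection[OF assms(1) P lt[unfolded D_def]], rule that)
    show ?thesis by (intro exI[of _ K] exI[of _ z] conjI allI impI Kz)
  qed
  then obtain K z where Kz: "\<And>n. K n \<in> sets M" "\<And>n::nat. emeasure M H - ennreal (1 / Suc n) \<le> emeasure M (K n)"
     "\<And>n i. (\<lambda>w. z n w i) \<in> measurable M (count_space UNIV)" "\<And>n w m. w \<in> K n \<Longrightarrow> w \<in> P m (z n w)"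
    by metis
  define U where "U = (\<Union>n. K n)"
  have U: "U \<in> sets M" using Kz(1) by (auto simp: U_def)
  have KD: "U \<subseteq> D" using Kz(4) sets.sets_into_space[OF Kz(1)] by (fastforce simp: D_def U_def suslin_def)
  have "emeasure M H \<le> emeasure M U + ennreal (1 / Suc n)" for n :: nat
  proof -
    have "emeasure M (K n) \<le> emeasure M U" using U by (intro emeasure_mono) (auto simp: U_def)
    then have "emeasure M H - ennreal (1 / Suc n) \<le> emeasure M U" using Kz(2)[of n] by (rule order_trans[rotated])
    then show ?thesis by (simp add: ennreal_minus_le_iff add.commute)
  qed
  moreover have "(\<lambda>n. emeasure M U + ennreal (1 / Suc n)) \<longlonglongrightarrow> emeasure M U + ennreal 0"
    by (intro tendsto_intros tendsto_ennrealI LIMSEQ_Suc lim_1_over_n)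
  ultimately have "emeasure M H \<le> emeasure M U"
    by (metis (no_types, lifting) LIMSEQ_le_const add.right_neutral ennreal_0)
  then have eq: "emeasure M (H - U) = 0"
    using H KD U emeasure_Diff[of M U H]
    by (simp add: subset_trans diff_eq_0_ennreal less_top[symmetric])
  have "H - U \<in> null_sets M" using eq H U by auto
  then have "D - U \<in> null_sets M"
    by (rule complete2[rotated]) (use H in auto)
  then have "D \<in> sets M" using U KD
    by (metis Un_Diff_cancel Un_absorb1 null_setsD2 sets.Un)
  define k where "k w = (LEAST n. w \<in> K n)" for w
  have km: "k \<in> measurable M (count_space UNIV)"
    unfolding k_def
  proof (rule measurable_Least)
    fix j
    have "{w\<in>space M. w \<in> K j} \<in> sets M" using Kz(1)[of j] by simp
    then show "Measurable.pred M (\<lambda>w. w \<in> K j)" by (simp add: pred_def)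
  qed
  have zm: "(\<lambda>w. z (k w) w i) \<in> measurable M (count_space UNIV)" for i
    using measurable_compose_countable[OF Kz(3) km] .
  have sel: "w \<in> P m (z (k w) w)" if "w \<in> U" for w m
  proof -
    have "w \<in> K (k w)" unfolding k_def using that by (auto simp: U_def intro: LeastI)
    then show ?thesis by (rule Kz(4))
  qed
  have "AE w in M. w \<in> D \<longrightarrow> (\<forall>m. w \<in> P m (z (k w) w))"
    by (rule AE_I'[OF \<open>D - U \<in> null_sets M\<close>]) (use sel in auto)
  then show ?thesis using that[of "\<lambda>w. z (k w) w"] \<open>D \<in> sets M\<close> zm by blast
qed

section \<open>Coding a Polish space by sequences of integers\<close>

text \<open>
  The sequence of points \<open>d (\<sigma> n)\<close> is followed only as long as its jumps are small, so that it converges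
  for every \<open>\<sigma>\<close>; this makes the coding total, and continuous because the limit is approached at a rate
  that does not depend on \<open>\<sigma>\<close>.
\<close>

fun greedy_approx :: "(nat \<Rightarrow> 'e::metric_space) \<Rightarrow> (nat \<Rightarrow> nat) \<Rightarrow> nat \<Rightarrow> 'e" where
  "greedy_approx d \<sigma> 0 = d (\<sigma> 0)"
| "greedy_approx d \<sigma> (Suc n) =
    (if dist (d (\<sigma> (Suc n))) (greedy_approx d \<sigma> n) < (1/2)^n then d (\<sigma> (Suc n)) else greedy_approx d \<sigma> n)"

definition decode :: "(nat \<Rightarrow> 'e::metric_space) \<Rightarrow> (nat \<Rightarrow> nat) \<Rightarrow> 'e" where
  "decode d \<sigma> = lim (greedy_approx d \<sigma>)"

lemma greedy_approx_cong:
  "(\<And>i. i \<le> n \<Longrightarrow> \<tau> i = \<sigma> i) \<Longrightarrow> greedy_approx d \<tau> n = greedy_approx d \<sigma> n"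
  by (induction n) auto

lemma dist_greedy_approx: "dist (greedy_approx d \<sigma> (n + k)) (greedy_approx d \<sigma> n) \<le> 2 * (1/2)^n - 2 * (1/2)^(n + k)"
proof (induction k)
  case (Suc k)
  have "dist (greedy_approx d \<sigma> (Suc (n + k))) (greedy_approx d \<sigma> (n + k)) \<le> (1/2)^(n + k)"
    by auto
  then have "dist (greedy_approx d \<sigma> (Suc (n + k))) (greedy_approx d \<sigma> n) \<le> (1/2)^(n + k) + (2 * (1/2)^n - 2 * (1/2)^(n + k))"
    using Suc dist_triangle[of "greedy_approx d \<sigma> (Suc (n + k))" "greedy_approx d \<sigma> n" "greedy_approx d \<sigma> (n + k)"]
    by linarith
  then show ?case by simp
qed simp

lemma dist_greedy_approx_le:
  assumes "n \<le> m"
  shows "dist (greedy_approx d \<sigma> m) (greedy_approx d \<sigma> n) \<le> 2 * (1/2)^n"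
proof -
  obtain k where k: "m = n + k" using assms le_Suc_ex by blast
  have "(0::real) \<le> 2 * (1/2)^(n + k)" by simp
  then show ?thesis unfolding k using dist_greedy_approx[of d \<sigma> n k] by linarith
qed

lemma LIMSEQ_half_power: "(\<lambda>n. c * (1/2)^n) \<longlonglongrightarrow> (0::real)"
  using tendsto_mult_right_zero[OF LIMSEQ_power_zero[of "1/2::real"]] by simp

lemma greedy_approx_tendsto:
  fixes d :: "nat \<Rightarrow> 'e::complete_space"
  shows "greedy_approx d \<sigma> \<longlonglongrightarrow> decode d \<sigma>"
proof -
  have "Cauchy (greedy_approx d \<sigma>)"
  proof (rule metric_CauchyI)
    fix e :: real assume "0 < e"
    then obtain N where N: "4 * (1/2)^N < e"
      using order_tendstoD(2)[OF LIMSEQ_half_power[of 4]] eventually_sequentially by (metis le_refl)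
    have "dist (greedy_approx d \<sigma> m) (greedy_approx d \<sigma> n) < e" if "m \<ge> N" "n \<ge> N" for m n
      using dist_triangle2[of "greedy_approx d \<sigma> m" "greedy_approx d \<sigma> n" "greedy_approx d \<sigma> N"]
        dist_greedy_approx_le[OF that(1), of d \<sigma>] dist_greedy_approx_le[OF that(2), of d \<sigma>] N
      by linarith
    then show "\<exists>N. \<forall>m\<ge>N. \<forall>n\<ge>N. dist (greedy_approx d \<sigma> m) (greedy_approx d \<sigma> n) < e" by blast
  qed
  then show ?thesis unfolding decode_def
    using Cauchy_convergent convergent_LIMSEQ_iff by blast
qed

lemma dist_decode:
  fixes d :: "nat \<Rightarrow> 'e::complete_space"
  shows "dist (decode d \<sigma>) (greedy_approx d \<sigma> n) \<le> 2 * (1/2)^n"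
  by (rule LIMSEQ_le_const2[OF tendsto_dist[OF greedy_approx_tendsto tendsto_const]])
     (use dist_greedy_approx_le in blast)

text \<open>
  The limit is within \<open>2 (1/2)\<^sup>n\<close> of the \<open>n\<close>-th approximation, so it lies in the open ball of radius
  \<open>3 (1/2)\<^sup>n\<close>.  Thus membership of the limit in an open set is a countable disjunction of conditions on
  finitely many entries of the code.
\<close>

lemma decode_in_open_iff:
  fixes d :: "nat \<Rightarrow> 'e::complete_space"
  assumes "open U"
  shows "decode d \<sigma> \<in> U \<longleftrightarrow> (\<exists>n. ball (greedy_approx d \<sigma> n) (3 * (1/2)^n) \<subseteq> U)"
proof
  assume "decode d \<sigma> \<in> U"
  then obtain e where e: "e > 0" "ball (decode d \<sigma>) e \<subseteq> U" using assms openE by blast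
  then obtain n where n: "5 * (1/2)^n < e"
    using order_tendstoD(2)[OF LIMSEQ_half_power[of 5]] eventually_sequentially by (metis le_refl)
  have "ball (greedy_approx d \<sigma> n) (3 * (1/2)^n) \<subseteq> ball (decode d \<sigma>) e"
  proof
    fix y assume "y \<in> ball (greedy_approx d \<sigma> n) (3 * (1/2)^n)"
    then show "y \<in> ball (decode d \<sigma>) e"
      using dist_triangle[of "decode d \<sigma>" y "greedy_approx d \<sigma> n"] dist_decode[of d \<sigma> n] n by simp
  qed
  then show "\<exists>n. ball (greedy_approx d \<sigma> n) (3 * (1/2)^n) \<subseteq> U" using e by blast
next
  assume "\<exists>n. ball (greedy_approx d \<sigma> n) (3 * (1/2)^n) \<subseteq> U"
  then obtain n where n: "ball (greedy_approx d \<sigma> n) (3 * (1/2)^n) \<subseteq> U" by blast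
  have "(0::real) < (1/2)^n" by simp
  then have "decode d \<sigma> \<in> ball (greedy_approx d \<sigma> n) (3 * (1/2)^n)"
    using dist_decode[of d \<sigma> n] unfolding mem_ball dist_commute[of "greedy_approx d \<sigma> n"]
    by linarith
  with n show "decode d \<sigma> \<in> U" by blast
qed

text \<open>
  If \<open>d (\<sigma> n)\<close> is within \<open>(1/2)\<^sup>n / 4\<close> of the target, then no jump is ever refused.
\<close>

lemma decode_surj:
  fixes d :: "nat \<Rightarrow> 'e::complete_space"
  assumes dense: "\<And>e r. 0 < r \<Longrightarrow> \<exists>n. dist (d n) e < r"
  shows "\<exists>\<sigma>. decode d \<sigma> = e"
proof -
  have "\<exists>\<sigma>. \<forall>n. dist (d (\<sigma> n)) e < (1/2)^n / 4"
    by (intro choice allI dense) simp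
  then obtain \<sigma> where \<sigma>: "\<And>n. dist (d (\<sigma> n)) e < (1/2)^n / 4" by blast
  have eq: "greedy_approx d \<sigma> n = d (\<sigma> n)" for n
  proof (induction n)
    case (Suc n)
    have "(0::real) < (1/2)^n" by simp
    then have "dist (d (\<sigma> (Suc n))) (d (\<sigma> n)) < (1/2)^n"
      using dist_triangle2[of "d (\<sigma> (Suc n))" "d (\<sigma> n)" e] \<sigma>[of n] \<sigma>[of "Suc n"]
      unfolding power_Suc by linarith
    with Suc show ?case by simp
  qed simp
  have "(\<lambda>n. d (\<sigma> n)) \<longlonglongrightarrow> e"
  proof (rule metric_tendsto_imp_tendsto[OF LIMSEQ_half_power[of "1/4"]])
    show "\<forall>\<^sub>F n in sequentially. dist (d (\<sigma> n)) e \<le> dist (1 / 4 * (1 / 2) ^ n) (0::real)"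
      by (rule always_eventually) (use \<sigma> in \<open>auto intro: less_imp_le\<close>)
  qed
  then have "decode d \<sigma> = e"
    using greedy_approx_tendsto[of d \<sigma>] unfolding eq[abs_def] by (rule LIMSEQ_unique[rotated])
  then show ?thesis by blast
qed

lemma measurable_decode:
  fixes d :: "nat \<Rightarrow> 'e::{complete_space, second_countable_topology}"
  assumes [measurable]: "\<And>i. (\<lambda>w. z w i) \<in> measurable M (count_space UNIV)"
  shows "(\<lambda>w. decode d (z w)) \<in> borel_measurable M"
proof (rule borel_measurable_LIMSEQ_metric[OF _ greedy_approx_tendsto])
  have [measurable]: "(\<lambda>w. d (z w n)) \<in> borel_measurable M" for n
    by (rule measurable_compose[OF assms[of n]]) simp
  show "(\<lambda>w. greedy_approx d (z w) n) \<in> borel_measurable M" for n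
  proof (induction n)
    case (Suc n)
    note [measurable] = Suc
    show ?case by simp
  qed simp
qed

section \<open>Measurable selection from product measurable sets\<close>

definition finitely_determined2 :: "((nat \<Rightarrow> nat) \<Rightarrow> (nat \<Rightarrow> nat) \<Rightarrow> 'b) \<Rightarrow> bool" where
  "finitely_determined2 q \<longleftrightarrow> (\<forall>\<sigma> \<tau>. \<exists>F. finite F \<and>
     (\<forall>\<sigma>' \<tau>'. (\<forall>i\<in>F. \<sigma>' i = \<sigma> i \<and> \<tau>' i = \<tau> i) \<longrightarrow> q \<sigma>' \<tau>' = q \<sigma> \<tau>))"

text \<open>
  Suslin sets in the product of \<open>\<Omega>\<close> with the space of codes, given by their sections: \<open>\<sigma>\<close> codes the point
  of \<open>E\<close>, and \<open>\<tau>\<close> is an auxiliary witness that is projected away.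
\<close>

definition suslin_section :: "'w measure \<Rightarrow> ((nat \<Rightarrow> nat) \<Rightarrow> 'w set) \<Rightarrow> bool" where
  "suslin_section M B \<longleftrightarrow> (\<exists>Q. (\<forall>m \<sigma> \<tau>. Q m \<sigma> \<tau> \<in> sets M) \<and> (\<forall>m::nat. finitely_determined2 (Q m)) \<and>
     (\<forall>\<sigma>. B \<sigma> = {w\<in>space M. \<exists>\<tau>. \<forall>m. w \<in> Q m \<sigma> \<tau>}))"

text \<open>
  The first entry of the witness chooses the member of the union, and the remaining entries form a
  witness for this member.
\<close>

lemma suslin_section_UN:
  assumes "\<And>k::nat. suslin_section M (B k)"
  shows "suslin_section M (\<lambda>\<sigma>. \<Union>k. B k \<sigma>)"
proof -
  have "\<exists>Q. \<forall>k. (\<forall>m \<sigma> \<tau>. Q k m \<sigma> \<tau> \<in> sets M) \<and> (\<forall>m::nat. finitely_determined2 (Q k m)) \<and>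
     (\<forall>\<sigma>. B k \<sigma> = {w\<in>space M. \<exists>\<tau>. \<forall>m. w \<in> Q k m \<sigma> \<tau>})"
    by (intro choice allI assms[unfolded suslin_section_def])
  then obtain Q where Q: "\<And>k m \<sigma> \<tau>. Q k m \<sigma> \<tau> \<in> sets M" "\<And>k m::nat. finitely_determined2 (Q k m)"
    "\<And>k \<sigma>. B k \<sigma> = {w\<in>space M. \<exists>\<tau>. \<forall>m. w \<in> Q k m \<sigma> \<tau>}"
    by blast
  define R where "R m \<sigma> \<tau> = Q (\<tau> 0) m \<sigma> (\<lambda>i. \<tau> (Suc i))" for m \<sigma> \<tau>
  have "finitely_determined2 (R m)" for m
    unfolding finitely_determined2_def
  proof (intro allI)
    fix \<sigma> \<tau> :: "nat \<Rightarrow> nat"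
    obtain F where F: "finite F" "\<And>\<sigma>' \<tau>'. (\<forall>i\<in>F. \<sigma>' i = \<sigma> i \<and> \<tau>' i = \<tau> (Suc i)) \<Longrightarrow>
        Q (\<tau> 0) m \<sigma>' \<tau>' = Q (\<tau> 0) m \<sigma> (\<lambda>i. \<tau> (Suc i))"
      using Q(2)[of "\<tau> 0" m] unfolding finitely_determined2_def by meson
    show "\<exists>F. finite F \<and> (\<forall>\<sigma>' \<tau>'. (\<forall>i\<in>F. \<sigma>' i = \<sigma> i \<and> \<tau>' i = \<tau> i) \<longrightarrow> R m \<sigma>' \<tau>' = R m \<sigma> \<tau>)"
    proof (intro exI conjI allI impI)
      show "finite (insert 0 (F \<union> Suc ` F))" using F(1) by simp
      fix \<sigma>' \<tau>' assume "\<forall>i\<in>insert 0 (F \<union> Suc ` F). \<sigma>' i = \<sigma> i \<and> \<tau>' i = \<tau> i"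
      then show "R m \<sigma>' \<tau>' = R m \<sigma> \<tau>" using F(2)[of \<sigma>' "\<lambda>i. \<tau>' (Suc i)"] by (simp add: R_def)
    qed
  qed
  moreover have "(\<Union>k. B k \<sigma>) = {w\<in>space M. \<exists>\<tau>. \<forall>m. w \<in> R m \<sigma> \<tau>}" for \<sigma>
  proof (intro subset_antisym subsetI)
    fix w assume "w \<in> (\<Union>k. B k \<sigma>)"
    then obtain k \<tau> where "w \<in> space M" "\<forall>m. w \<in> Q k m \<sigma> \<tau>" by (auto simp: Q(3))
    then show "w \<in> {w\<in>space M. \<exists>\<tau>. \<forall>m. w \<in> R m \<sigma> \<tau>}"
      by (auto simp: R_def intro!: exI[of _ "case_nat k \<tau>"])
  next
    fix w assume "w \<in> {w\<in>space M. \<exists>\<tau>. \<forall>m. w \<in> R m \<sigma> \<tau>}"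
    then obtain \<tau> where w: "w \<in> space M" "\<forall>m. w \<in> Q (\<tau> 0) m \<sigma> (\<lambda>i. \<tau> (Suc i))"
      by (auto simp: R_def)
    then have "w \<in> B (\<tau> 0) \<sigma>" unfolding Q(3) by blast
    then show "w \<in> (\<Union>k. B k \<sigma>)" by blast
  qed
  moreover have "R m \<sigma> \<tau> \<in> sets M" for m \<sigma> \<tau> by (simp add: R_def Q(1))
  ultimately show ?thesis unfolding suslin_section_def by (intro exI[of _ R]) simp
qed

text \<open>
  The witness, read through a pairing function, carries a witness for every member of the intersection.
\<close>

lemma suslin_section_INT:
  assumes "\<And>k::nat. suslin_section M (B k)"
  shows "suslin_section M (\<lambda>\<sigma>. \<Inter>k. B k \<sigma>)"
proof -
  have "\<exists>Q. \<forall>k. (\<forall>m \<sigma> \<tau>. Q k m \<sigma> \<tau> \<in> sets M) \<and> (\<forall>m::nat. finitely_determined2 (Q k m)) \<and>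
     (\<forall>\<sigma>. B k \<sigma> = {w\<in>space M. \<exists>\<tau>. \<forall>m. w \<in> Q k m \<sigma> \<tau>})"
    by (intro choice allI assms[unfolded suslin_section_def])
  then obtain Q where Q: "\<And>k m \<sigma> \<tau>. Q k m \<sigma> \<tau> \<in> sets M" "\<And>k m::nat. finitely_determined2 (Q k m)"
    "\<And>k \<sigma>. B k \<sigma> = {w\<in>space M. \<exists>\<tau>. \<forall>m. w \<in> Q k m \<sigma> \<tau>}"
    by blast
  define R where "R n \<sigma> \<tau> = (case prod_decode n of (k, m) \<Rightarrow> Q k m \<sigma> (\<lambda>i. \<tau> (prod_encode (k, i))))" for n \<sigma> \<tau>
  have "finitely_determined2 (R n)" for n
    unfolding finitely_determined2_def
  proof (intro allI)
    fix \<sigma> \<tau> :: "nat \<Rightarrow> nat"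
    obtain k m where km: "prod_decode n = (k, m)" by fastforce
    obtain F where F: "finite F" "\<And>\<sigma>' \<tau>'. (\<forall>i\<in>F. \<sigma>' i = \<sigma> i \<and> \<tau>' i = \<tau> (prod_encode (k, i))) \<Longrightarrow>
        Q k m \<sigma>' \<tau>' = Q k m \<sigma> (\<lambda>i. \<tau> (prod_encode (k, i)))"
      using Q(2)[of k m] unfolding finitely_determined2_def by meson
    show "\<exists>F. finite F \<and> (\<forall>\<sigma>' \<tau>'. (\<forall>i\<in>F. \<sigma>' i = \<sigma> i \<and> \<tau>' i = \<tau> i) \<longrightarrow> R n \<sigma>' \<tau>' = R n \<sigma> \<tau>)"
    proof (intro exI conjI allI impI)
      show "finite (F \<union> (\<lambda>i. prod_encode (k, i)) ` F)" using F(1) by simp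
      fix \<sigma>' \<tau>' assume "\<forall>i\<in>F \<union> (\<lambda>i. prod_encode (k, i)) ` F. \<sigma>' i = \<sigma> i \<and> \<tau>' i = \<tau> i"
      then show "R n \<sigma>' \<tau>' = R n \<sigma> \<tau>"
        using F(2)[of \<sigma>' "\<lambda>i. \<tau>' (prod_encode (k, i))"] by (simp add: R_def km)
    qed
  qed
  moreover have "(\<Inter>k. B k \<sigma>) = {w\<in>space M. \<exists>\<tau>. \<forall>m. w \<in> R m \<sigma> \<tau>}" for \<sigma>
  proof (intro subset_antisym subsetI)
    fix w assume "w \<in> (\<Inter>k. B k \<sigma>)"
    then have w: "w \<in> space M" "\<forall>k. \<exists>\<tau>. \<forall>m. w \<in> Q k m \<sigma> \<tau>" by (auto simp: Q(3))
    then obtain t where t: "\<And>k m. w \<in> Q k m \<sigma> (t k)" by metis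
    have "w \<in> R n \<sigma> (\<lambda>j. case prod_decode j of (k, i) \<Rightarrow> t k i)" for n
      using t by (simp add: R_def split: prod.split)
    with w(1) show "w \<in> {w\<in>space M. \<exists>\<tau>. \<forall>m. w \<in> R m \<sigma> \<tau>}" by blast
  next
    fix w assume "w \<in> {w\<in>space M. \<exists>\<tau>. \<forall>m. w \<in> R m \<sigma> \<tau>}"
    then obtain \<tau> where w: "w \<in> space M" "\<And>n. w \<in> R n \<sigma> \<tau>" by blast
    have "w \<in> Q k m \<sigma> (\<lambda>i. \<tau> (prod_encode (k, i)))" for k m
      using w(2)[of "prod_encode (k, m)"] by (simp add: R_def)
    then show "w \<in> (\<Inter>k. B k \<sigma>)" unfolding Q(3) using w(1) by blast
  qed
  moreover have "R m \<sigma> \<tau> \<in> sets M" for m \<sigma> \<tau> by (simp add: R_def Q(1) split: prod.split)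
  ultimately show ?thesis unfolding suslin_section_def by (intro exI[of _ R]) simp
qed

lemma suslin_section_clopen:
  assumes "\<And>\<sigma>. B \<sigma> \<in> sets M" "finitely_determined B"
  shows "suslin_section M B"
proof -
  have "finitely_determined2 (\<lambda>\<sigma> (\<tau>::nat \<Rightarrow> nat). B \<sigma>)"
    unfolding finitely_determined2_def
  proof (intro allI)
    fix \<sigma> \<tau> :: "nat \<Rightarrow> nat"
    obtain F where F: "finite F" "\<And>\<sigma>'. (\<forall>i\<in>F. \<sigma>' i = \<sigma> i) \<Longrightarrow> B \<sigma>' = B \<sigma>"
      using assms(2) unfolding finitely_determined_def by meson
    then show "\<exists>F. finite F \<and> (\<forall>\<sigma>' \<tau>'. (\<forall>i\<in>F. \<sigma>' i = \<sigma> i \<and> \<tau>' i = \<tau> i) \<longrightarrow> B \<sigma>' = B \<sigma>)" by meson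
  qed
  moreover have "B \<sigma> = {w\<in>space M. w \<in> B \<sigma>}" for \<sigma>
    using sets.sets_into_space[OF assms(1)] by blast
  ultimately show ?thesis using assms(1) unfolding suslin_section_def
    by (intro exI[of _ "\<lambda>m \<sigma> \<tau>. B \<sigma>"]) simp
qed

definition graph_section :: "'w measure \<Rightarrow> (nat \<Rightarrow> 'e::metric_space) \<Rightarrow> ('w \<times> 'e) set \<Rightarrow> (nat \<Rightarrow> nat) \<Rightarrow> 'w set" where
  "graph_section M d A \<sigma> = {w\<in>space M. (w, decode d \<sigma>) \<in> A}"

text \<open>
  Suslin sets need not be closed under complements; requiring the property of the complement as well
  gives a \<open>\<sigma>\<close>-algebra.
\<close>

definition bisuslin :: "'w measure \<Rightarrow> (nat \<Rightarrow> 'e::metric_space) \<Rightarrow> ('w \<times> 'e) set \<Rightarrow> bool" where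
  "bisuslin M d A \<longleftrightarrow> suslin_section M (graph_section M d A) \<and> suslin_section M (graph_section M d (- A))"

lemma bisuslin_Compl: "bisuslin M d A \<Longrightarrow> bisuslin M d (- A)"
  by (simp add: bisuslin_def)

lemma bisuslin_UN:
  assumes "\<And>k::nat. bisuslin M d (A k)"
  shows "bisuslin M d (\<Union>k. A k)"
proof -
  have "graph_section M d (\<Union>k. A k) = (\<lambda>\<sigma>. \<Union>k. graph_section M d (A k) \<sigma>)"
    "graph_section M d (- (\<Union>k. A k)) = (\<lambda>\<sigma>. \<Inter>k. graph_section M d (- A k) \<sigma>)"
    by (auto simp: graph_section_def fun_eq_iff)
  then show ?thesis using assms unfolding bisuslin_def
    by (simp add: suslin_section_UN suslin_section_INT)
qed

lemma bisuslin_cong: "(\<And>w e. w \<in> space M \<Longrightarrow> (w, e) \<in> A \<longleftrightarrow> (w, e) \<in> B) \<Longrightarrow> bisuslin M d A \<longleftrightarrow> bisuslin M d B"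
proof -
  assume "\<And>w e. w \<in> space M \<Longrightarrow> (w, e) \<in> A \<longleftrightarrow> (w, e) \<in> B"
  then have "graph_section M d A = graph_section M d B" "graph_section M d (-A) = graph_section M d (-B)"
    by (auto simp: graph_section_def fun_eq_iff)
  then show ?thesis by (simp add: bisuslin_def)
qed

lemma bisuslin_Int:
  assumes "bisuslin M d A" "bisuslin M d B"
  shows "bisuslin M d (A \<inter> B)"
proof -
  have "bisuslin M d (- (\<Union>k::nat. if k = 0 then - A else - B))"
    by (intro bisuslin_Compl bisuslin_UN) (use assms bisuslin_Compl in auto)
  moreover have "- (\<Union>k::nat. if k = 0 then - A else - B) = A \<inter> B"
    by (auto split: if_splits)
  ultimately show ?thesis by simp
qed

lemma bisuslin_base:
  assumes "T \<in> sets M"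
  shows "bisuslin M d (T \<times> UNIV)"
proof -
  have "graph_section M d (T \<times> UNIV) = (\<lambda>_. T)" "graph_section M d (- (T \<times> UNIV)) = (\<lambda>_. space M - T)"
    using sets.sets_into_space[OF assms] by (auto simp: graph_section_def fun_eq_iff)
  moreover have "finitely_determined (\<lambda>_. S)" for S :: "'a set"
    by (auto simp: finitely_determined_def)
  ultimately show ?thesis using assms unfolding bisuslin_def by (auto intro: suslin_section_clopen)
qed

lemma bisuslin_open:
  fixes d :: "nat \<Rightarrow> 'e::complete_space"
  assumes "open U"
  shows "bisuslin M d (UNIV \<times> U)"
proof -
  define C where "C n \<sigma> \<longleftrightarrow> ball (greedy_approx d \<sigma> n) (3 * (1/2)^n) \<subseteq> U" for n \<sigma>
  have C: "finitely_determined (\<lambda>\<sigma>. if C n \<sigma> then S else S')" for n and S S' :: "'a set"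
    unfolding finitely_determined_def
  proof (intro allI exI conjI impI)
    show "finite {..n}" by simp
    fix \<sigma> \<tau> :: "nat \<Rightarrow> nat" assume "\<forall>i\<in>{..n}. \<tau> i = \<sigma> i"
    then have "greedy_approx d \<tau> n = greedy_approx d \<sigma> n" by (intro greedy_approx_cong) auto
    then show "(if C n \<tau> then S else S') = (if C n \<sigma> then S else S')" by (simp add: C_def)
  qed
  define inside outside where "inside n \<sigma> = (if C n \<sigma> then space M else {})"
    and "outside n \<sigma> = (if C n \<sigma> then {} else space M)" for n \<sigma>
  have "w \<in> inside n \<sigma> \<longleftrightarrow> w \<in> space M \<and> C n \<sigma>" "w \<in> outside n \<sigma> \<longleftrightarrow> w \<in> space M \<and> \<not> C n \<sigma>" for w n \<sigma>
    by (simp_all add: inside_def outside_def)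
  then have "graph_section M d (UNIV \<times> U) = (\<lambda>\<sigma>. \<Union>n. inside n \<sigma>)"
    "graph_section M d (- (UNIV \<times> U)) = (\<lambda>\<sigma>. \<Inter>n. outside n \<sigma>)"
    using decode_in_open_iff[OF assms, of d, folded C_def]
    by (auto simp: graph_section_def fun_eq_iff)
  moreover have "suslin_section M (inside n)" "suslin_section M (outside n)" for n
    unfolding inside_def outside_def by (auto intro!: suslin_section_clopen C)
  ultimately show ?thesis unfolding bisuslin_def
    by (simp add: suslin_section_UN suslin_section_INT)
qed

lemma bisuslin_borel:
  fixes d :: "nat \<Rightarrow> 'e::complete_space" and M :: "'w measure"
  assumes "S \<in> sets borel"
  shows "bisuslin M d (UNIV \<times> S)"
proof -
  have "S \<in> sigma_sets UNIV {S. open S}" using assms by (simp add: borel_def)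
  then show ?thesis
  proof (induction rule: sigma_sets.induct)
    case (Compl S)
    have "- ((UNIV :: 'w set) \<times> S) = UNIV \<times> (UNIV - S)" by auto
    then show ?case using bisuslin_Compl[OF Compl.IH] by (simp only:)
  next
    case (Union S)
    have "(\<Union>k. (UNIV :: 'w set) \<times> S k) = UNIV \<times> (\<Union>k. S k)" by auto
    then show ?case using bisuslin_UN[of M d "\<lambda>k. UNIV \<times> S k", OF Union.IH] by (simp only:)
  next
    case Empty
    show ?case by (rule bisuslin_open) simp
  qed (auto intro: bisuslin_open)
qed

lemma bisuslin_pair_measure:
  fixes d :: "nat \<Rightarrow> 'e::complete_space"
  assumes "A \<in> sets (M \<Otimes>\<^sub>M (borel :: 'e measure))"
  shows "bisuslin M d A"
proof -
  have "A \<in> sigma_sets (space M \<times> UNIV) {a \<times> b | a b. a \<in> sets M \<and> b \<in> sets (borel :: 'e measure)}"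
    using assms by (simp add: sets_pair_measure)
  then show ?thesis
  proof (induction rule: sigma_sets.induct)
    case (Basic a)
    then obtain T S where "a = T \<times> S" "T \<in> sets M" "S \<in> sets (borel :: 'e measure)" by blast
    moreover have "T \<times> S = (T \<times> UNIV) \<inter> (UNIV \<times> S)" by auto
    ultimately show ?case using bisuslin_Int[OF bisuslin_base[of T M d] bisuslin_borel[of S M d]] by simp
  next
    case Empty
    have "bisuslin M d (UNIV \<times> {})" by (rule bisuslin_borel) simp
    then show ?case by simp
  next
    case (Compl a)
    have "bisuslin M d (- a)" by (rule bisuslin_Compl[OF Compl.IH])
    then show ?case by (subst bisuslin_cong[where B="- a"]) auto
  next
    case (Union a)
    then show ?case by (intro bisuslin_UN)
  qed
qed

lemma dense_sequence:
  obtains d :: "nat \<Rightarrow> 'e::{metric_space, second_countable_topology}"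
  where "\<And>e r. 0 < r \<Longrightarrow> \<exists>n. dist (d n) e < r"
proof -
  obtain D :: "'e set" where D: "countable D" "\<And>X. open X \<Longrightarrow> X \<noteq> {} \<Longrightarrow> \<exists>d\<in>D. d \<in> X"
    using countable_dense_exists by blast
  have "D \<noteq> {}" using D(2)[of UNIV] by auto
  show ?thesis
  proof (rule that[of "from_nat_into D"])
    fix e :: 'e and r :: real assume "0 < r"
    then obtain x where "x \<in> D" "x \<in> ball e r" using D(2)[of "ball e r"] by auto
    then show "\<exists>n. dist (from_nat_into D n) e < r"
      using from_nat_into_surj[OF D(1)] by (metis dist_commute mem_ball)
  qed
qed

text \<open>
  The code of the point of \<open>E\<close> and the witness are merged into a single branch \<open>\<zeta>\<close>; the projection to
  \<open>\<Omega>\<close> is then the result of a Suslin operation, and decoding the selected branch gives the selection.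
\<close>

lemma measurable_selection_finite:
  fixes M :: "'w measure" and A :: "('w \<times> 'e::{complete_space, second_countable_topology}) set"
  assumes "finite_measure M" "complete_measure M" and A: "A \<in> sets (M \<Otimes>\<^sub>M borel)"
  shows "fst ` A \<in> sets M \<and> (\<exists>s\<in>borel_measurable M. AE w in M. w \<in> fst ` A \<longrightarrow> (w, s w) \<in> A)"
proof -
  obtain d :: "nat \<Rightarrow> 'e" where d: "\<And>e r. 0 < r \<Longrightarrow> \<exists>n. dist (d n) e < r"
    by (rule dense_sequence, rule that)
  have "suslin_section M (graph_section M d A)"
    using bisuslin_pair_measure[OF A] by (simp add: bisuslin_def)
  then obtain Q where Q: "\<And>m \<sigma> \<tau>. Q m \<sigma> \<tau> \<in> sets M" "\<And>m::nat. finitely_determined2 (Q m)"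
    "\<And>\<sigma>. graph_section M d A \<sigma> = {w\<in>space M. \<exists>\<tau>. \<forall>m. w \<in> Q m \<sigma> \<tau>}"
    unfolding suslin_section_def by blast
  define l r where "l \<zeta> i = fst (prod_decode (\<zeta> i))" and "r \<zeta> i = snd (prod_decode (\<zeta> i))"
    for \<zeta> :: "nat \<Rightarrow> nat" and i
  define P where "P m \<zeta> = Q m (l \<zeta>) (r \<zeta>)" for m \<zeta>
  have det: "finitely_determined (P m)" for m
    unfolding finitely_determined_def
  proof
    fix \<zeta>
    obtain F where F: "finite F" "\<And>\<sigma>' \<tau>'. (\<forall>i\<in>F. \<sigma>' i = l \<zeta> i \<and> \<tau>' i = r \<zeta> i) \<Longrightarrow> Q m \<sigma>' \<tau>' = Q m (l \<zeta>) (r \<zeta>)"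
      using Q(2)[of m] unfolding finitely_determined2_def by meson
    show "\<exists>F. finite F \<and> (\<forall>\<tau>. (\<forall>i\<in>F. \<tau> i = \<zeta> i) \<longrightarrow> P m \<tau> = P m \<zeta>)"
      unfolding P_def
    proof (intro exI conjI allI impI)
      show "finite F" by fact
      fix \<tau> assume "\<forall>i\<in>F. \<tau> i = \<zeta> i"
      then show "Q m (l \<tau>) (r \<tau>) = Q m (l \<zeta>) (r \<zeta>)" by (intro F(2)) (simp add: l_def r_def)
    qed
  qed
  have Pm: "P m \<zeta> \<in> sets M" for m \<zeta> by (simp add: P_def Q(1))
  have "w \<in> fst ` A \<longleftrightarrow> w \<in> suslin (space M) P" for w
  proof
    assume "w \<in> fst ` A"
    then obtain e where e: "(w, e) \<in> A" by force
    obtain \<sigma> where "decode d \<sigma> = e" using decode_surj[OF d] by metis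
    moreover have "w \<in> space M" using sets.sets_into_space[OF A] e by (auto simp: space_pair_measure)
    ultimately have "w \<in> graph_section M d A \<sigma>" using e by (simp add: graph_section_def)
    then obtain \<tau> where \<tau>: "\<And>m. w \<in> Q m \<sigma> \<tau>" unfolding Q(3) by blast
    define \<zeta> where "\<zeta> i = prod_encode (\<sigma> i, \<tau> i)" for i
    have "l \<zeta> = \<sigma>" "r \<zeta> = \<tau>" by (simp_all add: \<zeta>_def l_def r_def fun_eq_iff)
    then have "w \<in> P m \<zeta>" for m using \<tau> by (simp add: P_def)
    then show "w \<in> suslin (space M) P" using \<open>w \<in> space M\<close> unfolding suslin_def by blast
  next
    assume "w \<in> suslin (space M) P"
    then obtain \<zeta> where "w \<in> space M" "\<And>m. w \<in> Q m (l \<zeta>) (r \<zeta>)"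
      unfolding suslin_def P_def by blast
    then have "w \<in> graph_section M d A (l \<zeta>)" unfolding Q(3) by blast
    then show "w \<in> fst ` A" by (force simp: graph_section_def)
  qed
  then have proj: "fst ` A = suslin (space M) P" by blast
  obtain z where z: "suslin (space M) P \<in> sets M" "\<And>i. (\<lambda>w. z w i) \<in> measurable M (count_space UNIV)"
    "AE w in M. w \<in> suslin (space M) P \<longrightarrow> (\<forall>m. w \<in> P m (z w))"
    by (rule suslin_selection_finite[OF assms(1,2) Pm det], rule that)
  define s where "s w = decode d (l (z w))" for w
  have "s \<in> borel_measurable M" unfolding s_def
  proof (rule measurable_decode)
    show "(\<lambda>w. l (z w) i) \<in> measurable M (count_space UNIV)" for i
      unfolding l_def by (rule measurable_compose[OF z(2)]) simp
  qed
  moreover have "AE w in M. w \<in> fst ` A \<longrightarrow> (w, s w) \<in> A"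
    using z(3)
  proof (rule AE_mp, intro AE_I2 impI)
    fix w assume w: "w \<in> space M" "w \<in> suslin (space M) P \<longrightarrow> (\<forall>m. w \<in> P m (z w))" "w \<in> fst ` A"
    then have "\<And>m. w \<in> Q m (l (z w)) (r (z w))" by (simp add: proj P_def)
    with w(1) have "w \<in> graph_section M d A (l (z w))" unfolding Q(3) by blast
    then show "(w, s w) \<in> A" by (simp add: graph_section_def s_def)
  qed
  ultimately show ?thesis using z(1) proj by auto
qed

text \<open>
  The selection theorem of Aumann and von Neumann.  Passing to a finite measure with a strictly positive
  density changes neither the measurable sets nor the null sets.
\<close>

theorem measurable_selection:
  fixes M :: "'w measure" and A :: "('w \<times> 'e::{complete_space, second_countable_topology}) set"
  assumes "sigma_finite_measure M" "complete_measure M" and A: "A \<in> sets (M \<Otimes>\<^sub>M borel)"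
  obtains s where "fst ` A \<in> sets M" "s \<in> borel_measurable M" "AE w in M. w \<in> fst ` A \<longrightarrow> (w, s w) \<in> A"
proof -
  interpret sigma_finite_measure M by fact
  interpret complete_measure M by fact
  obtain f :: "'w \<Rightarrow> real" where f: "f \<in> borel_measurable M" "\<And>x. f x > 0" "integrable M f"
    by (rule obtain_positive_integrable_function, rule that)
  define N where "N = density M (\<lambda>x. ennreal (f x))"
  have setsN: "sets N = sets M" and spN: "space N = space M" by (simp_all add: N_def)
  have fm: "(\<lambda>x. ennreal (f x)) \<in> borel_measurable M" using f(1) by simp
  have "emeasure N (space N) = (\<integral>\<^sup>+x. ennreal (f x) \<partial>M)"
    using fm by (simp add: N_def emeasure_density cong: nn_integral_cong)
  then have "finite_measure N"
    using f by (intro finite_measureI) (simp add: nn_integral_eq_integral less_imp_le)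
  moreover have AEN: "(AE w in N. Q w) \<longleftrightarrow> (AE w in M. Q w)" for Q
    unfolding N_def using f(2) by (subst AE_density[OF fm]) simp
  have null: "X \<in> null_sets N \<longleftrightarrow> X \<in> null_sets M" for X
  proof (cases "X \<in> sets M")
    case True
    then have "X \<in> sets N" by (simp add: setsN)
    then show ?thesis using Measure_Space.AE_iff_null_sets[OF True] Measure_Space.AE_iff_null_sets[of X N] AEN
      by simp
  next
    case False
    then show ?thesis using setsN by (auto dest: null_setsD2)
  qed
  have "complete_measure N"
  proof
    fix A B assume "B \<subseteq> A" "A \<in> null_sets N"
    then have "B \<in> sets M" using complete[of B A] null[of A] by simp
    then show "B \<in> sets N" using setsN by simp
  qed
  moreover have "A \<in> sets (N \<Otimes>\<^sub>M borel)" using A sets_pair_measure_cong[OF setsN refl] by metis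
  ultimately have *: "fst ` A \<in> sets N \<and> (\<exists>s\<in>borel_measurable N. AE w in N. w \<in> fst ` A \<longrightarrow> (w, s w) \<in> A)"
    by (intro measurable_selection_finite)
  then obtain s where "s \<in> borel_measurable N" "AE w in N. w \<in> fst ` A \<longrightarrow> (w, s w) \<in> A" by blast
  moreover have "borel_measurable N = (borel_measurable M :: ('w \<Rightarrow> 'e) set)" by (rule measurable_cong_sets[OF setsN refl])
  ultimately have "s \<in> borel_measurable M" "AE w in M. w \<in> fst ` A \<longrightarrow> (w, s w) \<in> A"
    using AEN by simp_all
  then show ?thesis using that[of s] * setsN by simp
qed

section \<open>The upper integral\<close>

lemma upper_integral_le:
  assumes "integrable M u" "AE w in M. v w \<le> ereal (u w)"
  shows "upper_integral M v \<le> ereal (\<integral>w. u w \<partial>M)"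
  unfolding upper_integral_def using assms by (intro INF_lower) auto

lemma upper_integral_greatest:
  assumes "\<And>u. integrable M u \<Longrightarrow> AE w in M. v w \<le> ereal (u w) \<Longrightarrow> c \<le> ereal (\<integral>w. u w \<partial>M)"
  shows "c \<le> upper_integral M v"
  unfolding upper_integral_def using assms by (intro INF_greatest) auto

lemma upper_integral_less_obtain:
  assumes "upper_integral M v < c"
  obtains u where "integrable M u" "AE w in M. v w \<le> ereal (u w)" "ereal (\<integral>w. u w \<partial>M) < c"
  using assms unfolding upper_integral_def INF_less_iff by auto

lemma upper_integral_cong_AE:
  assumes "AE w in M. v w = v' w"
  shows "upper_integral M v = upper_integral M v'"
proof -
  have "(AE w in M. v w \<le> ereal (u w)) \<longleftrightarrow> (AE w in M. v' w \<le> ereal (u w))" for u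
  proof
    assume "AE w in M. v w \<le> ereal (u w)"
    with assms show "AE w in M. v' w \<le> ereal (u w)" by eventually_elim simp
  next
    assume "AE w in M. v' w \<le> ereal (u w)"
    with assms show "AE w in M. v w \<le> ereal (u w)" by eventually_elim simp
  qed
  then show ?thesis by (simp add: upper_integral_def)
qed

lemma integrable_real_of_nonneg:
  fixes v :: "'w \<Rightarrow> ereal"
  assumes v[measurable]: "v \<in> borel_measurable M" and nn: "\<forall>w\<in>space M. 0 \<le> v w"
    and fin: "(\<integral>\<^sup>+w. e2ennreal (v w) \<partial>M) < \<infinity>"
  shows "integrable M (\<lambda>w. real_of_ereal (v w))" "AE w in M. \<bar>v w\<bar> \<noteq> \<infinity>"
    "ennreal (\<integral>w. real_of_ereal (v w) \<partial>M) = (\<integral>\<^sup>+w. e2ennreal (v w) \<partial>M)"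
proof -
  have "AE w in M. e2ennreal (v w) \<noteq> \<infinity>"
    using fin by (intro nn_integral_noteq_infinite) auto
  then show eq: "AE w in M. \<bar>v w\<bar> \<noteq> \<infinity>"
  proof (rule AE_mp, intro AE_I2 impI)
    fix w assume w: "w \<in> space M" "e2ennreal (v w) \<noteq> \<infinity>"
    then show "\<bar>v w\<bar> \<noteq> \<infinity>"
      using bspec[OF nn w(1)] by (cases "v w") auto
  qed
  have nnr: "AE w in M. 0 \<le> real_of_ereal (v w)" using nn by (intro AE_I2) (simp add: real_of_ereal_pos)
  have "(\<integral>\<^sup>+w. ennreal (real_of_ereal (v w)) \<partial>M) = (\<integral>\<^sup>+w. e2ennreal (v w) \<partial>M)"
  proof (rule nn_integral_cong_AE, rule AE_mp[OF eq], intro AE_I2 impI)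
    fix w assume "\<bar>v w\<bar> \<noteq> \<infinity>"
    then show "ennreal (real_of_ereal (v w)) = e2ennreal (v w)" by (cases "v w") auto
  qed
  moreover from this show int: "integrable M (\<lambda>w. real_of_ereal (v w))"
    using fin nnr by (intro integrableI_nonneg) auto
  ultimately show "ennreal (\<integral>w. real_of_ereal (v w) \<partial>M) = (\<integral>\<^sup>+w. e2ennreal (v w) \<partial>M)"
    using nn_integral_eq_integral[OF int nnr] by simp
qed

lemma upper_integral_le_iff_nn_integral_le:
  fixes v :: "'w \<Rightarrow> ereal"
  assumes v: "v \<in> borel_measurable M" and nn: "\<forall>w\<in>space M. 0 \<le> v w" and c: "0 \<le> c"
  shows "upper_integral M v \<le> ereal c \<longleftrightarrow> (\<integral>\<^sup>+w. e2ennreal (v w) \<partial>M) \<le> ennreal c"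
proof
  assume le: "upper_integral M v \<le> ereal c"
  show "(\<integral>\<^sup>+w. e2ennreal (v w) \<partial>M) \<le> ennreal c"
  proof (rule ennreal_le_epsilon)
    fix \<delta> :: real assume "0 < \<delta>"
    then have "upper_integral M v < ereal (c + \<delta>)" using le by (simp add: le_less_trans)
    then obtain u where u: "integrable M u" "AE w in M. v w \<le> ereal (u w)" "ereal (\<integral>w. u w \<partial>M) < ereal (c + \<delta>)"
      by (rule upper_integral_less_obtain)
    have u0: "AE w in M. 0 \<le> u w"
      using u(2)
    proof (rule AE_mp, intro AE_I2 impI)
      fix w assume "w \<in> space M" "v w \<le> ereal (u w)"
      then have "0 \<le> ereal (u w)" using bspec[OF nn, of w] by (meson order_trans)
      then show "0 \<le> u w" by simp
    qed
    have "(\<integral>\<^sup>+w. e2ennreal (v w) \<partial>M) \<le> (\<integral>\<^sup>+w. ennreal (u w) \<partial>M)"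
    proof (rule nn_integral_mono_AE, rule AE_mp[OF u(2)], intro AE_I2 impI)
      fix w assume "v w \<le> ereal (u w)"
      from e2ennreal_mono[OF this] show "e2ennreal (v w) \<le> ennreal (u w)" by simp
    qed
    also have "\<dots> = ennreal (\<integral>w. u w \<partial>M)" by (rule nn_integral_eq_integral[OF u(1) u0])
    also have "\<dots> \<le> ennreal (c + \<delta>)" using u(3) by (intro ennreal_leI) simp
    finally show "(\<integral>\<^sup>+w. e2ennreal (v w) \<partial>M) \<le> ennreal c + ennreal \<delta>"
      using c \<open>0 < \<delta>\<close> by (simp add: ennreal_plus)
  qed
next
  assume le: "(\<integral>\<^sup>+w. e2ennreal (v w) \<partial>M) \<le> ennreal c"
  then have fin: "(\<integral>\<^sup>+w. e2ennreal (v w) \<partial>M) < \<infinity>" by (rule le_less_trans) simp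
  note r = integrable_real_of_nonneg[OF v nn fin]
  have "upper_integral M v \<le> ereal (\<integral>w. real_of_ereal (v w) \<partial>M)"
  proof (rule upper_integral_le[OF r(1)], rule AE_mp[OF r(2)], intro AE_I2 impI)
    fix w assume "\<bar>v w\<bar> \<noteq> \<infinity>"
    then show "v w \<le> ereal (real_of_ereal (v w))" by (cases "v w") auto
  qed
  moreover have "(\<integral>w. real_of_ereal (v w) \<partial>M) \<le> c"
    using le c by (simp add: r(3)[symmetric] ennreal_le_iff)
  ultimately show "upper_integral M v \<le> ereal c" by (meson ereal_less_eq(3) order_trans)
qed

text \<open>
  If \<open>v\<close> were \<open>- \<infinity>\<close> on a set \<open>B\<close> of positive measure, any integrable majorant could be lowered by
  arbitrary multiples of a positive integrable function on \<open>B\<close>, and the upper integral would be \<open>- \<infinity>\<close>.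
\<close>

lemma AE_finite_of_upper_integral_finite:
  fixes v :: "'w \<Rightarrow> ereal"
  assumes "sigma_finite_measure M" and v[measurable]: "v \<in> borel_measurable M"
    and fin: "\<bar>upper_integral M v\<bar> \<noteq> \<infinity>"
  shows "AE w in M. \<bar>v w\<bar> \<noteq> \<infinity>"
proof -
  interpret sigma_finite_measure M by fact
  have "upper_integral M v < \<infinity>" using fin by auto
  then obtain u where u: "integrable M u" "AE w in M. v w \<le> ereal (u w)"
    by (rule upper_integral_less_obtain)
  obtain p :: "'w \<Rightarrow> real" where p: "p \<in> borel_measurable M" "\<And>w. 0 < p w" "integrable M p"
    by (rule obtain_positive_integrable_function, rule that)
  define B where "B = {w\<in>space M. v w = -\<infinity>}"
  have B[measurable]: "B \<in> sets M" by (simp add: B_def)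
  define q where "q w = p w * indicator B w" for w
  have q: "integrable M q" unfolding q_def using p(3) B by (rule integrable_real_mult_indicator[rotated])
  have q0: "AE w in M. 0 \<le> q w" using p(2) by (simp add: q_def less_imp_le)
  have "upper_integral M v \<le> ereal ((\<integral>w. u w \<partial>M) - real n * (\<integral>w. q w \<partial>M))" for n :: nat
  proof -
    have "upper_integral M v \<le> ereal (\<integral>w. u w - real n * q w \<partial>M)"
    proof (rule upper_integral_le)
      show "integrable M (\<lambda>w. u w - real n * q w)" using u q by auto
      show "AE w in M. v w \<le> ereal (u w - real n * q w)"
        using u(2) by (rule AE_mp) (auto simp: q_def B_def indicator_def)
    qed
    then show ?thesis using u q by simp
  qed
  moreover obtain r where r: "upper_integral M v = ereal r" using fin by auto
  ultimately have *: "real n * (\<integral>w. q w \<partial>M) \<le> (\<integral>w. u w \<partial>M) - r" for n :: nat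
    by (simp add: algebra_simps)
  have "\<not> 0 < (\<integral>w. q w \<partial>M)"
    using reals_Archimedean3[of "\<integral>w. q w \<partial>M"] * by (meson linorder_not_less)
  moreover have "0 \<le> (\<integral>w. q w \<partial>M)" using q0 by (rule integral_nonneg_AE)
  ultimately have "(\<integral>w. q w \<partial>M) = 0" by simp
  then have "AE w in M. q w = 0" using integral_nonneg_eq_0_iff_AE[OF q q0] by simp
  then have "AE w in M. w \<notin> B"
    by (rule AE_mp) (use p(2) in \<open>auto simp: q_def less_le\<close>)
  with u(2) show ?thesis
  proof (rule AE_mp[OF AE_conjI], intro AE_I2 impI)
    fix w assume "w \<in> space M" "v w \<le> ereal (u w) \<and> w \<notin> B"
    then show "\<bar>v w\<bar> \<noteq> \<infinity>" by (cases "v w") (auto simp: B_def)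
  qed
qed

section \<open>Young integrands, the modular and the Orlicz norm\<close>

lemma measurable_integrand_compose:
  assumes "measurable_integrand M f" and [measurable]: "x \<in> borel_measurable M"
  shows "(\<lambda>w. f w (x w)) \<in> borel_measurable M"
proof -
  have "(\<lambda>w. (w, x w)) \<in> measurable M (M \<Otimes>\<^sub>M borel)" by measurable
  from measurable_compose[OF this assms(1)[unfolded measurable_integrand_def]]
  show ?thesis by simp
qed

text \<open>
  A Caratheodory argument: for a countable dense family \<open>d\<close>, the pairing with \<open>e\<close> is the limit of the
  pairings with \<open>d (k n e)\<close>, where \<open>k n\<close> takes countably many values.
\<close>

lemma measurable_scalar_pairing:
  fixes x' :: "'w \<Rightarrow> ('e::{real_normed_vector, second_countable_topology} \<Rightarrow>\<^sub>L real)"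
  assumes "scalarly_measurable M x'"
  shows "(\<lambda>(w, e). blinfun_apply (x' w) e) \<in> borel_measurable (M \<Otimes>\<^sub>M borel)"
proof -
  obtain d :: "nat \<Rightarrow> 'e" where d: "\<And>e r. 0 < r \<Longrightarrow> \<exists>n. dist (d n) e < r"
    by (rule dense_sequence, rule that)
  define k where "k n e = (LEAST i. dist (d i) e < inverse (Suc n))" for n e
  have kd: "dist (d (k n e)) e < inverse (Suc n)" for n e
    unfolding k_def by (rule LeastI_ex, rule d) simp
  have km: "k n \<in> measurable borel (count_space UNIV)" for n
    unfolding k_def by measurable
  have lim: "(\<lambda>n. d (k n e)) \<longlonglongrightarrow> e" for e
    by (rule metric_tendsto_imp_tendsto[OF LIMSEQ_inverse_real_of_nat])
       (use kd in \<open>auto intro!: always_eventually less_imp_le\<close>)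
  show ?thesis
  proof (rule borel_measurable_LIMSEQ_metric)
    fix n
    have m: "(\<lambda>p. blinfun_apply (x' (fst p)) (d i)) \<in> borel_measurable (M \<Otimes>\<^sub>M borel)" for i
      using assms by (intro measurable_compose[OF measurable_fst]) (simp add: scalarly_measurable_def)
    have "(\<lambda>p. k n (snd p)) \<in> measurable (M \<Otimes>\<^sub>M borel) (count_space UNIV)"
      by (rule measurable_compose[OF measurable_snd km])
    from measurable_compose_countable[OF m this]
    show "(\<lambda>p. blinfun_apply (x' (fst p)) (d (k n (snd p)))) \<in> borel_measurable (M \<Otimes>\<^sub>M borel)" .
  next
    fix p :: "'w \<times> 'e"
    show "(\<lambda>n. blinfun_apply (x' (fst p)) (d (k n (snd p)))) \<longlonglongrightarrow> (case p of (w, e) \<Rightarrow> blinfun_apply (x' w) e)"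
      by (simp add: case_prod_beta) (intro tendsto_intros lim)
  qed
qed

lemma e2ennreal_convex:
  assumes "0 \<le> a" "0 \<le> b" "0 \<le> h" "0 \<le> k"
  shows "e2ennreal (ereal a * h + ereal b * k) = ennreal a * e2ennreal h + ennreal b * e2ennreal k"
  using assms
  by (cases h; cases k; cases "a = 0"; cases "b = 0")
     (auto simp: ennreal_mult ennreal_mult_top e2ennreal_neg)

locale young_setting =
  fixes M :: "'w measure" and \<phi> :: "'w \<Rightarrow> 'e::{banach, second_countable_topology} \<Rightarrow> ereal"
  assumes measurable_phi: "measurable_integrand M \<phi>" and young_phi: "young_integrand M \<phi>"
begin

definition modular :: "('w \<Rightarrow> 'e) \<Rightarrow> ennreal" where
  "modular x = (\<integral>\<^sup>+w. e2ennreal (\<phi> w (x w)) \<partial>M)"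

lemma young: "w \<in> space M \<Longrightarrow> young_function (\<phi> w)"
  using young_phi by (simp add: young_integrand_def)

lemma phi_nonneg: "w \<in> space M \<Longrightarrow> 0 \<le> \<phi> w e"
  by (drule young, unfold young_function_def, elim conjE, simp)

lemma phi_zero: "w \<in> space M \<Longrightarrow> \<phi> w 0 = 0"
  by (drule young, unfold young_function_def, elim conjE, simp)

lemma phi_minus: "w \<in> space M \<Longrightarrow> \<phi> w (- e) = \<phi> w e"
  by (drule young, unfold young_function_def, elim conjE, simp)

lemma phi_convex: "w \<in> space M \<Longrightarrow> 0 \<le> a \<Longrightarrow> 0 \<le> b \<Longrightarrow> a + b = 1 \<Longrightarrow>
    \<phi> w (a *\<^sub>R x + b *\<^sub>R y) \<le> ereal a * \<phi> w x + ereal b * \<phi> w y"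
  by (drule young, unfold young_function_def, elim conjE, simp)

lemma measurable_phi_comp: "x \<in> borel_measurable M \<Longrightarrow> (\<lambda>w. \<phi> w (x w)) \<in> borel_measurable M"
  by (rule measurable_integrand_compose[OF measurable_phi])

lemma int_functional_phi_le_iff:
  "x \<in> borel_measurable M \<Longrightarrow> int_functional M \<phi> x \<le> 1 \<longleftrightarrow> modular x \<le> 1"
  using upper_integral_le_iff_nn_integral_le[OF measurable_phi_comp, of x 1] phi_nonneg
  by (simp add: int_functional_def modular_def one_ereal_def)

lemma modular_convex:
  assumes x[measurable]: "x \<in> borel_measurable M" and y[measurable]: "y \<in> borel_measurable M"
    and ab: "0 \<le> a" "0 \<le> b" "a + b = 1"
  shows "modular (\<lambda>w. a *\<^sub>R x w + b *\<^sub>R y w) \<le> ennreal a * modular x + ennreal b * modular y"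
proof -
  note [measurable] = measurable_phi_comp
  have "modular (\<lambda>w. a *\<^sub>R x w + b *\<^sub>R y w) \<le>
      (\<integral>\<^sup>+w. ennreal a * e2ennreal (\<phi> w (x w)) + ennreal b * e2ennreal (\<phi> w (y w)) \<partial>M)"
    unfolding modular_def
    by (intro nn_integral_mono)
       (metis phi_convex[OF _ ab] e2ennreal_mono e2ennreal_convex[OF ab(1,2) phi_nonneg phi_nonneg])
  also have "\<dots> = ennreal a * modular x + ennreal b * modular y"
    unfolding modular_def by (simp add: nn_integral_add nn_integral_cmult)
  finally show ?thesis .
qed

lemma modular_zero: "modular (\<lambda>_. 0) = 0"
  unfolding modular_def by (subst nn_integral_cong[of _ _ "\<lambda>_. 0"]) (auto simp: phi_zero e2ennreal_neg)

lemma modular_scale: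
  assumes "x \<in> borel_measurable M" "0 \<le> a" "a \<le> 1"
  shows "modular (\<lambda>w. a *\<^sub>R x w) \<le> ennreal a * modular x"
  using modular_convex[of x "\<lambda>_. 0" a "1 - a"] assms by (simp add: modular_zero)

lemma orlicz_space_iff:
  "x \<in> orlicz_space M \<phi> \<longleftrightarrow> x \<in> borel_measurable M \<and> (\<exists>t>0. modular (\<lambda>w. inverse t *\<^sub>R x w) \<le> 1)"
  unfolding orlicz_space_def by (auto simp: int_functional_phi_le_iff)

lemma orlicz_norm_eq:
  "x \<in> borel_measurable M \<Longrightarrow> orlicz_norm M \<phi> x = Inf {t. 0 < t \<and> modular (\<lambda>w. inverse t *\<^sub>R x w) \<le> 1}"
  unfolding orlicz_norm_def by (simp add: int_functional_phi_le_iff)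

lemma orlicz_space_measurable: "x \<in> orlicz_space M \<phi> \<Longrightarrow> x \<in> borel_measurable M"
  by (simp add: orlicz_space_iff)

lemma orlicz_space_uminus: "x \<in> orlicz_space M \<phi> \<Longrightarrow> (\<lambda>w. - x w) \<in> orlicz_space M \<phi>"
proof -
  have "modular (\<lambda>w. inverse t *\<^sub>R - x w) = modular (\<lambda>w. inverse t *\<^sub>R x w)" for t
    unfolding modular_def by (intro nn_integral_cong) (simp add: phi_minus)
  then show "x \<in> orlicz_space M \<phi> \<Longrightarrow> (\<lambda>w. - x w) \<in> orlicz_space M \<phi>"
    by (simp add: orlicz_space_iff)
qed

lemma orlicz_space_add:
  assumes "x \<in> orlicz_space M \<phi>" "y \<in> orlicz_space M \<phi>"
  shows "(\<lambda>w. x w + y w) \<in> orlicz_space M \<phi>"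
proof -
  have [measurable]: "x \<in> borel_measurable M" "y \<in> borel_measurable M"
    using assms orlicz_space_measurable by auto
  obtain t s where t: "t > 0" "modular (\<lambda>w. inverse t *\<^sub>R x w) \<le> 1"
    and s: "s > 0" "modular (\<lambda>w. inverse s *\<^sub>R y w) \<le> 1"
    using assms orlicz_space_iff by blast
  define a b where "a = t / (t + s)" and "b = s / (t + s)"
  have ab: "0 \<le> a" "0 \<le> b" "a + b = 1" using t s by (auto simp: a_def b_def add_divide_distrib[symmetric])
  have "inverse (t + s) *\<^sub>R (x w + y w) = a *\<^sub>R (inverse t *\<^sub>R x w) + b *\<^sub>R (inverse s *\<^sub>R y w)" for w
    using t(1) s(1) by (simp add: a_def b_def scaleR_add_right inverse_eq_divide)
  then have "modular (\<lambda>w. inverse (t + s) *\<^sub>R (x w + y w))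
      \<le> ennreal a * modular (\<lambda>w. inverse t *\<^sub>R x w) + ennreal b * modular (\<lambda>w. inverse s *\<^sub>R y w)"
    by (simp only:) (rule modular_convex[OF _ _ ab]; measurable)
  also have "\<dots> \<le> ennreal a * 1 + ennreal b * 1"
    using t s by (intro add_mono mult_left_mono) auto
  also have "\<dots> = 1" using ab by (simp add: ennreal_plus[symmetric] del: ennreal_plus)
  finally show ?thesis using t(1) s(1) by (auto simp: orlicz_space_iff intro!: exI[of _ "t + s"])
qed

lemma orlicz_space_diff:
  "x \<in> orlicz_space M \<phi> \<Longrightarrow> y \<in> orlicz_space M \<phi> \<Longrightarrow> (\<lambda>w. x w - y w) \<in> orlicz_space M \<phi>"
  using orlicz_space_add[OF _ orlicz_space_uminus] by simp

lemma orlicz_norm_le: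
  assumes "x \<in> borel_measurable M" "0 < t" "modular (\<lambda>w. inverse t *\<^sub>R x w) \<le> 1"
  shows "orlicz_norm M \<phi> x \<le> t"
  unfolding orlicz_norm_eq[OF assms(1)] using assms
  by (intro cInf_lower bdd_belowI[of _ 0]) auto

lemma orlicz_norm_nonneg: "x \<in> orlicz_space M \<phi> \<Longrightarrow> 0 \<le> orlicz_norm M \<phi> x"
  by (auto simp: orlicz_norm_eq orlicz_space_iff intro!: cInf_greatest)

text \<open>
  The inequality is strict since \<open>\<phi> w\<close> may jump to \<open>\<infinity>\<close> at the boundary of its domain, in which case the
  infimum that defines the norm need not be attained.
\<close>

lemma modular_le_of_norm_less:
  assumes "x \<in> orlicz_space M \<phi>" "orlicz_norm M \<phi> x < t"
  shows "modular (\<lambda>w. inverse t *\<^sub>R x w) \<le> 1"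
proof -
  have [measurable]: "x \<in> borel_measurable M" using assms orlicz_space_measurable by auto
  obtain s where s: "0 < s" "modular (\<lambda>w. inverse s *\<^sub>R x w) \<le> 1" "s < t"
    using assms cInf_lessD[of "{t. 0 < t \<and> modular (\<lambda>w. inverse t *\<^sub>R x w) \<le> 1}" t]
    by (auto simp: orlicz_norm_eq orlicz_space_iff)
  have "inverse t *\<^sub>R x w = (s / t) *\<^sub>R (inverse s *\<^sub>R x w)" for w
    using s by (simp add: inverse_eq_divide)
  then have "modular (\<lambda>w. inverse t *\<^sub>R x w) \<le> ennreal (s / t) * modular (\<lambda>w. inverse s *\<^sub>R x w)"
    by (simp only:) (rule modular_scale; use s in simp)
  also have "\<dots> \<le> 1 * 1"
    using s by (intro mult_mono) (auto simp: ennreal_le_1)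
  finally show ?thesis by simp
qed

text \<open>
  If the norm vanishes, the modular of every multiple of \<open>x\<close> is at most \<open>1\<close>; by convexity it is at most
  \<open>1 / n\<close> for every \<open>n\<close>, so \<open>\<phi> w (k x w) = 0\<close> for all \<open>k\<close>, whereas \<open>\<phi> w\<close> tends to infinity.
\<close>

lemma orlicz_norm_eq_0D:
  assumes x: "x \<in> orlicz_space M \<phi>" and "orlicz_norm M \<phi> x = 0"
  shows "AE w in M. x w = 0"
proof -
  have [measurable]: "x \<in> borel_measurable M" using x orlicz_space_measurable by auto
  note [measurable] = measurable_phi_comp
  have le: "modular (\<lambda>w. real n *\<^sub>R x w) \<le> 1" if "n > 0" for n
    using modular_le_of_norm_less[OF x, of "inverse (real n)"] assms(2) that by simp
  have "AE w in M. \<phi> w (real k *\<^sub>R x w) = 0" for k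
  proof -
    have "modular (\<lambda>w. real k *\<^sub>R x w) \<le> ennreal (1 / real (Suc n))" for n
    proof -
      have "modular (\<lambda>w. real k *\<^sub>R x w) \<le> modular (\<lambda>w. real (Suc k) *\<^sub>R x w)"
      proof -
        have "real k *\<^sub>R x w = (real k / real (Suc k)) *\<^sub>R (real (Suc k) *\<^sub>R x w)" for w
          by (simp del: of_nat_Suc)
        then have "modular (\<lambda>w. real k *\<^sub>R x w) \<le> ennreal (real k / real (Suc k)) * modular (\<lambda>w. real (Suc k) *\<^sub>R x w)"
          by (simp only:) (rule modular_scale; simp)
        also have "\<dots> \<le> 1 * modular (\<lambda>w. real (Suc k) *\<^sub>R x w)"
          by (intro mult_right_mono) (auto simp: ennreal_le_1)
        finally show ?thesis by simp
      qed
      also have "\<dots> \<le> ennreal (1 / real (Suc n)) * modular (\<lambda>w. real (Suc n * Suc k) *\<^sub>R x w)"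
      proof -
        have "real (Suc k) *\<^sub>R x w = (1 / real (Suc n)) *\<^sub>R (real (Suc n * Suc k) *\<^sub>R x w)" for w
          unfolding of_nat_mult by (simp del: of_nat_Suc)
        then show ?thesis
          by (simp only:) (rule modular_scale; simp)
      qed
      also have "\<dots> \<le> ennreal (1 / real (Suc n)) * 1"
        by (intro mult_left_mono le) auto
      finally show ?thesis by simp
    qed
    moreover have "(\<lambda>n. ennreal (1 / real (Suc n))) \<longlonglongrightarrow> ennreal 0"
      by (intro tendsto_ennrealI LIMSEQ_Suc lim_1_over_n)
    ultimately have "modular (\<lambda>w. real k *\<^sub>R x w) \<le> ennreal 0"
      by (intro LIMSEQ_le_const) auto
    then have "(\<integral>\<^sup>+w. e2ennreal (\<phi> w (real k *\<^sub>R x w)) \<partial>M) = 0" by (simp add: modular_def)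
    then have "AE w in M. e2ennreal (\<phi> w (real k *\<^sub>R x w)) = 0"
      by (subst (asm) nn_integral_0_iff_AE) auto
    then show ?thesis
    proof (rule AE_mp, intro AE_I2 impI)
      fix w assume "w \<in> space M" "e2ennreal (\<phi> w (real k *\<^sub>R x w)) = 0"
      then show "\<phi> w (real k *\<^sub>R x w) = 0"
        using phi_nonneg by (metis enn2ereal_e2ennreal zero_ennreal.rep_eq)
    qed
  qed
  then have "AE w in M. \<forall>k::nat. \<phi> w (real k *\<^sub>R x w) = 0" by (simp add: AE_all_countable)
  then show ?thesis
  proof (rule AE_mp, intro AE_I2 impI)
    fix w assume w: "w \<in> space M" "\<forall>k::nat. \<phi> w (real k *\<^sub>R x w) = 0"
    show "x w = 0"
    proof (rule ccontr)
      assume nz: "x w \<noteq> 0"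
      have "(\<phi> w \<longlongrightarrow> \<infinity>) at_infinity"
        using young[OF w(1)] unfolding young_function_def by (elim conjE)
      then have "\<forall>\<^sub>F e in at_infinity. 0 < \<phi> w e" by (rule order_tendstoD) simp
      then obtain b where b: "\<And>e. b \<le> norm e \<Longrightarrow> 0 < \<phi> w e" by (auto simp: eventually_at_infinity)
      obtain k :: nat where "b / norm (x w) \<le> real k" using real_arch_simple by blast
      then have "b \<le> norm (real k *\<^sub>R x w)" using nz by (simp add: field_simps)
      from b[OF this] w(2) show False by simp
    qed
  qed
qed

text \<open>
  Young's inequality, applied to \<open>x' / t\<close> and \<open>\<plusminus> y / s\<close>, bounds the modulus of the pairing by \<open>t s\<close> times
  a sum of two integrable majorants.
\<close>

lemma pairing_integrable:
  assumes x': "x' \<in> dual_orlicz_space M \<phi>" and y: "y \<in> orlicz_space M \<phi>"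
  shows "integrable M (\<lambda>w. blinfun_apply (x' w) (y w))"
proof -
  have [measurable]: "y \<in> borel_measurable M" using y orlicz_space_measurable by auto
  obtain t where t: "t > 0" "int_functional M (conjugate_integrand \<phi>) (\<lambda>w. inverse t *\<^sub>R x' w) \<le> 1"
    and sm: "scalarly_measurable M x'"
    using x' by (auto simp: dual_orlicz_space_def)
  obtain s where s: "s > 0" "int_functional M \<phi> (\<lambda>w. inverse s *\<^sub>R y w) \<le> 1"
    using y by (auto simp: orlicz_space_def)
  have "int_functional M (conjugate_integrand \<phi>) (\<lambda>w. inverse t *\<^sub>R x' w) < \<infinity>"
    using t(2) by (rule le_less_trans) (simp add: one_ereal_def)
  then obtain u where u: "integrable M u" "AE w in M. conjugate_integrand \<phi> w (inverse t *\<^sub>R x' w) \<le> ereal (u w)"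
    unfolding int_functional_def by (rule upper_integral_less_obtain)
  have "int_functional M \<phi> (\<lambda>w. inverse s *\<^sub>R y w) < \<infinity>"
    using s(2) by (rule le_less_trans) (simp add: one_ereal_def)
  then obtain v where v: "integrable M v" "AE w in M. \<phi> w (inverse s *\<^sub>R y w) \<le> ereal (v w)"
    unfolding int_functional_def by (rule upper_integral_less_obtain)
  have m: "(\<lambda>w. blinfun_apply (x' w) (y w)) \<in> borel_measurable M"
  proof -
    have "(\<lambda>w. (w, y w)) \<in> measurable M (M \<Otimes>\<^sub>M borel)" by measurable
    from measurable_compose[OF this measurable_scalar_pairing[OF sm]] show ?thesis by simp
  qed
  show ?thesis
  proof (rule Bochner_Integration.integrable_bound)
    show "integrable M (\<lambda>w. (t * s) * (u w + v w))" using u v by auto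
    show "(\<lambda>w. blinfun_apply (x' w) (y w)) \<in> borel_measurable M" by fact
    show "AE w in M. norm (blinfun_apply (x' w) (y w)) \<le> norm ((t * s) * (u w + v w))"
      using u(2) v(2)
    proof (rule AE_mp[OF AE_conjI], intro AE_I2 impI)
      fix w assume w: "w \<in> space M"
        "conjugate_integrand \<phi> w (inverse t *\<^sub>R x' w) \<le> ereal (u w) \<and> \<phi> w (inverse s *\<^sub>R y w) \<le> ereal (v w)"
      have key: "blinfun_apply (x' w) e / t \<le> u w + v w" if "\<phi> w e \<le> ereal (v w)" for e
      proof -
        have "ereal (blinfun_apply (inverse t *\<^sub>R x' w) e) - \<phi> w e \<le> conjugate_integrand \<phi> w (inverse t *\<^sub>R x' w)"
          unfolding conjugate_integrand_def by (rule SUP_upper) simp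
        also have "\<dots> \<le> ereal (u w)" using w by simp
        finally have "ereal (blinfun_apply (inverse t *\<^sub>R x' w) e) - \<phi> w e \<le> ereal (u w)" .
        then show ?thesis using that phi_nonneg[OF w(1), of e]
          by (cases "\<phi> w e") (auto simp: scaleR_blinfun.rep_eq field_simps)
      qed
      have "blinfun_apply (x' w) (inverse s *\<^sub>R y w) / t \<le> u w + v w"
        "blinfun_apply (x' w) (- (inverse s *\<^sub>R y w)) / t \<le> u w + v w"
        using w phi_minus[OF w(1)] by (auto intro!: key)
      then have "\<bar>blinfun_apply (x' w) (y w)\<bar> / (t * s) \<le> u w + v w"
        using s(1) t(1) by (auto simp: blinfun.scaleR_right blinfun.minus_right abs_if divide_inverse mult_ac)
      then show "norm (blinfun_apply (x' w) (y w)) \<le> norm ((t * s) * (u w + v w))"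
        using s(1) t(1) by (auto simp: field_simps abs_mult)
    qed
  qed
qed

end

section \<open>Frechet subderivatives on the Orlicz space\<close>

lemma eventually_orlicz_at:
  "eventually P (orlicz_at M \<phi> x0) \<longleftrightarrow> (\<exists>d>0. \<forall>x\<in>orlicz_space M \<phi>. \<not> (AE w in M. x w = x0 w) \<longrightarrow>
      orlicz_norm M \<phi> (\<lambda>w. x w - x0 w) < d \<longrightarrow> P x)"
  unfolding orlicz_at_def
proof (subst eventually_INF_base)
  show "{0<..} \<noteq> ({} :: real set)" using zero_less_one by blast
  fix a b :: real assume "a \<in> {0<..}" "b \<in> {0<..}"
  then show "\<exists>d\<in>{0<..}. principal {x \<in> orlicz_space M \<phi>. \<not> (AE w in M. x w = x0 w) \<and> orlicz_norm M \<phi> (\<lambda>w. x w - x0 w) < d}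
      \<le> inf (principal {x \<in> orlicz_space M \<phi>. \<not> (AE w in M. x w = x0 w) \<and> orlicz_norm M \<phi> (\<lambda>w. x w - x0 w) < a})
         (principal {x \<in> orlicz_space M \<phi>. \<not> (AE w in M. x w = x0 w) \<and> orlicz_norm M \<phi> (\<lambda>w. x w - x0 w) < b})"
    by (intro bexI[of _ "min a b"]) auto
qed (auto simp: eventually_principal)

text \<open>
  Off the class of \<open>x0\<close> the norm of \<open>x - x0\<close> is positive, so the denominator can be cleared.
\<close>

lemma (in young_setting) frechet_subderivative_iff:
  assumes J: "\<bar>J x0\<bar> \<noteq> \<infinity>" and x0: "x0 \<in> orlicz_space M \<phi>"
  shows "frechet_subderivative M \<phi> J x' x0 \<longleftrightarrow>
    (\<forall>\<eta>>0. \<exists>d>0. \<forall>x\<in>orlicz_space M \<phi>. \<not> (AE w in M. x w = x0 w) \<longrightarrow>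
      orlicz_norm M \<phi> (\<lambda>w. x w - x0 w) < d \<longrightarrow>
      J x0 + ereal (pairing M x' (\<lambda>w. x w - x0 w) - \<eta> * orlicz_norm M \<phi> (\<lambda>w. x w - x0 w)) \<le> J x)"
    (is "_ \<longleftrightarrow> ?R")
proof -
  let ?n = "\<lambda>x. orlicz_norm M \<phi> (\<lambda>w. x w - x0 w)"
  let ?p = "\<lambda>x. pairing M x' (\<lambda>w. x w - x0 w)"
  let ?q = "\<lambda>x. (J x - J x0 - ereal (?p x)) / ereal (?n x)"
  obtain j where j: "J x0 = ereal j" using J by auto
  have n: "0 < ?n x" if "x \<in> orlicz_space M \<phi>" "\<not> (AE w in M. x w = x0 w)" for x
  proof -
    note L = orlicz_space_diff[OF that(1) x0]
    have "?n x \<noteq> 0" using orlicz_norm_eq_0D[OF L] that(2) by auto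
    with orlicz_norm_nonneg[OF L] show ?thesis by simp
  qed
  have q: "ereal (- \<eta>) \<le> ?q x \<longleftrightarrow> J x0 + ereal (?p x - \<eta> * ?n x) \<le> J x" (is "?A \<longleftrightarrow> ?B")
    "ereal (- \<eta>) < ?q x \<longrightarrow> J x0 + ereal (?p x - \<eta> * ?n x) \<le> J x"
    if "x \<in> orlicz_space M \<phi>" "\<not> (AE w in M. x w = x0 w)" for x \<eta>
  proof -
    show "?A \<longleftrightarrow> ?B"
      using n[OF that] by (cases "J x") (auto simp: j field_simps)
    then show "ereal (- \<eta>) < ?q x \<longrightarrow> J x0 + ereal (?p x - \<eta> * ?n x) \<le> J x" by auto
  qed
  have "frechet_subderivative M \<phi> J x' x0 \<longleftrightarrow> (\<forall>y<0. eventually (\<lambda>x. y < ?q x) (orlicz_at M \<phi> x0))"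
    using J by (simp add: frechet_subderivative_def le_Liminf_iff)
  also have "\<dots> \<longleftrightarrow> ?R"
  proof
    assume L: "\<forall>y<0. eventually (\<lambda>x. y < ?q x) (orlicz_at M \<phi> x0)"
    show ?R
    proof (intro allI impI)
      fix \<eta> :: real assume "0 < \<eta>"
      then have "eventually (\<lambda>x. ereal (- \<eta>) < ?q x) (orlicz_at M \<phi> x0)" using L by simp
      then show "\<exists>d>0. \<forall>x\<in>orlicz_space M \<phi>. \<not> (AE w in M. x w = x0 w) \<longrightarrow> ?n x < d \<longrightarrow>
        J x0 + ereal (?p x - \<eta> * ?n x) \<le> J x"
        unfolding eventually_orlicz_at using q(2) by meson
    qed
  next
    assume R: ?R
    show "\<forall>y<0. eventually (\<lambda>x. y < ?q x) (orlicz_at M \<phi> x0)"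
    proof (intro allI impI)
      fix y :: ereal assume "y < 0"
      then obtain r where r: "y < ereal r" "ereal r < 0" using ereal_dense2 by blast
      then have "0 < - r" by simp
      from R[rule_format, OF this] obtain d where d: "d > 0"
        "\<And>x. x \<in> orlicz_space M \<phi> \<Longrightarrow> \<not> (AE w in M. x w = x0 w) \<Longrightarrow> ?n x < d \<Longrightarrow>
        J x0 + ereal (?p x - (- r) * ?n x) \<le> J x" by blast
      have "y < ?q x" if "x \<in> orlicz_space M \<phi>" "\<not> (AE w in M. x w = x0 w)" "?n x < d" for x
        using d(2)[OF that] q(1)[OF that(1,2), of "- r"] r(1) by (simp add: less_le_trans)
      then show "eventually (\<lambda>x. y < ?q x) (orlicz_at M \<phi> x0)"
        unfolding eventually_orlicz_at using d(1) by blast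
    qed
  qed
  finally show ?thesis .
qed

section \<open>Sets of intermediate measure\<close>

text \<open>
  Suppose that no set has measure between \<open>1/2\<close> and \<open>1\<close>.  Then sets of measure at most \<open>1/2\<close> are closed
  under finite unions (the union has measure at most \<open>1\<close>), hence under countable unions, so there is one,
  \<open>U\<close>, of largest measure.  By maximality a set disjoint from \<open>U\<close> is null or has measure more than \<open>1\<close>.
  Such a set of finite positive measure cannot exist: splitting it removes more than \<open>1\<close> from its
  measure each time.  So the complement of \<open>U\<close> is null, and the whole space has measure at most \<open>1/2\<close>.
\<close>

lemma exists_subset_measure_between:
  fixes N :: "'w measure"
  assumes "sigma_finite_measure N"
    and split: "\<And>A. A \<in> sets N \<Longrightarrow> 0 < emeasure N A \<Longrightarrow> emeasure N A < \<infinity> \<Longrightarrow>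
      \<exists>B\<in>sets N. B \<subseteq> A \<and> 0 < emeasure N B \<and> emeasure N B < emeasure N A"
    and large: "1 < emeasure N (space N)"
  shows "\<exists>B\<in>sets N. ennreal (1/2) \<le> emeasure N B \<and> emeasure N B \<le> 1"
proof (rule ccontr)
  assume neg: "\<not> ?thesis"
  interpret sigma_finite_measure N by fact
  have half: "emeasure N B < ennreal (1/2)" if "B \<in> sets N" "emeasure N B \<le> 1" for B
    using neg that by (auto simp: not_le)
  define small where "small = {B\<in>sets N. emeasure N B \<le> ennreal (1/2)}"
  have half1: "ennreal (1/2) \<le> 1" using ennreal_leI[of "1/2" 1] by simp
  have smallI: "B \<in> small" if "B \<in> sets N" "emeasure N B \<le> 1" for B
    using half[OF that] that by (simp add: small_def)
  have Un: "A \<union> B \<in> small" if "A \<in> small" "B \<in> small" for A B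
  proof (rule smallI)
    show "A \<union> B \<in> sets N" using that by (auto simp: small_def)
    have "emeasure N (A \<union> B) \<le> emeasure N A + emeasure N B"
      using that by (intro emeasure_subadditive) (auto simp: small_def)
    also have "\<dots> \<le> ennreal (1/2) + ennreal (1/2)"
      using that by (intro add_mono) (auto simp: small_def)
    also have "\<dots> = 1" by (subst ennreal_plus[symmetric]) auto
    finally show "emeasure N (A \<union> B) \<le> 1" .
  qed
  have "{} \<in> small" by (simp add: small_def)
  then have ne: "small \<noteq> {}" by blast
  obtain a :: "nat \<Rightarrow> ennreal" where a: "range a \<subseteq> emeasure N ` small" "(SUP B\<in>small. emeasure N B) = (SUP i. a i)"
    using ennreal_Sup_countable_SUP[of "emeasure N ` small"] ne by auto
  have "\<forall>i. \<exists>B. B \<in> small \<and> emeasure N B = a i" using a(1) by (auto simp: image_def subset_eq) metis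
  then obtain A where A: "\<And>i. A i \<in> small" "\<And>i. emeasure N (A i) = a i" by metis
  define C where "C n = (\<Union>i\<le>n. A i)" for n :: nat
  have Cs: "C n \<in> small" for n
  proof (induction n)
    case (Suc n)
    have "C (Suc n) = C n \<union> A (Suc n)" by (auto simp: C_def atMost_Suc)
    then show ?case using Un[OF Suc A(1)] by simp
  qed (simp add: C_def A(1))
  define U where "U = (\<Union>n. C n)"
  have Csets: "range C \<subseteq> sets N" using Cs by (auto simp: small_def)
  have inc: "incseq C" unfolding C_def by (intro monoI UN_mono) auto
  have "emeasure N U = (SUP n. emeasure N (C n))"
    unfolding U_def using SUP_emeasure_incseq[OF Csets inc] by simp
  also have "\<dots> \<le> ennreal (1/2)" using Cs by (intro SUP_least) (auto simp: small_def)
  finally have "emeasure N U \<le> ennreal (1/2)" .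
  moreover have Usets: "U \<in> sets N" using Csets by (auto simp: U_def)
  ultimately have Us: "U \<in> small" by (simp add: small_def)
  have Umax: "emeasure N B \<le> emeasure N U" if "B \<in> small" for B
  proof -
    have "emeasure N B \<le> (SUP i. a i)" unfolding a(2)[symmetric] using that by (rule SUP_upper)
    also have "\<dots> \<le> emeasure N U"
    proof (rule SUP_least)
      fix i
      have "A i \<subseteq> U" by (auto simp: U_def C_def)
      then show "a i \<le> emeasure N U" unfolding A(2)[symmetric] using Usets by (intro emeasure_mono)
    qed
    finally show ?thesis .
  qed
  have Ufin: "emeasure N U < \<infinity>"
    using \<open>emeasure N U \<le> ennreal (1/2)\<close>
    by (rule le_less_trans) (simp only: infinity_ennreal_def ennreal_less_top)
  have zero: "emeasure N B = 0" if B: "B \<in> sets N" "B \<subseteq> space N - U" "emeasure N B \<le> 1" for B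
  proof -
    have "emeasure N U + emeasure N B = emeasure N (U \<union> B)"
      using B Usets by (intro plus_emeasure) auto
    also have "\<dots> \<le> emeasure N U + 0"
      using Umax[OF Un[OF Us smallI[OF B(1,3)]]] by simp
    finally show ?thesis using Ufin by (subst (asm) ennreal_add_left_cancel_le) auto
  qed
  have null: "emeasure N B = 0" if "B \<in> sets N" "B \<subseteq> space N - U" "emeasure N B \<le> of_nat n" for B and n :: nat
    using that
  proof (induction n arbitrary: B)
    case (Suc n)
    show ?case
    proof (rule ccontr)
      assume "emeasure N B \<noteq> 0"
      moreover have Bfin: "emeasure N B < \<infinity>"
        using Suc.prems(3) by (rule le_less_trans) (simp add: of_nat_less_top)
      ultimately obtain B' where B': "B' \<in> sets N" "B' \<subseteq> B" "0 < emeasure N B'" "emeasure N B' < emeasure N B"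
        using split[OF Suc.prems(1)] by (auto simp: zero_less_iff_neq_zero)
      have sum: "emeasure N B' + emeasure N (B - B') = emeasure N B"
        using B'(1,2) Suc.prems(1) plus_emeasure[of B' N "B - B'"] by (simp add: Un_absorb1)
      have "\<not> emeasure N (B - B') \<le> 1"
      proof
        assume "emeasure N (B - B') \<le> 1"
        then have "emeasure N (B - B') = 0" using B' Suc.prems by (intro zero) auto
        then show False using sum B'(4) by simp
      qed
      then have "emeasure N B' + 1 \<le> emeasure N B' + emeasure N (B - B')" by (intro add_left_mono) simp
      also have "\<dots> \<le> of_nat n + 1" using Suc.prems(3) sum by (simp add: add.commute)
      finally have "emeasure N B' \<le> of_nat n" by (simp add: add.commute[of _ 1] ennreal_add_left_cancel_le)
      then have "emeasure N B' = 0" using B' Suc.prems by (intro Suc.IH) auto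
      with B'(3) show False by simp
    qed
  qed simp
  obtain S :: "nat \<Rightarrow> 'w set" where S: "range S \<subseteq> sets N" "(\<Union>i. S i) = space N" "\<And>i. emeasure N (S i) \<noteq> \<infinity>"
    using sigma_finite by auto
  have "emeasure N (S i - U) = 0" for i
  proof -
    have "emeasure N (S i - U) \<le> emeasure N (S i)" using S(1) by (intro emeasure_mono) auto
    moreover have "emeasure N (S i) < top" using S(3)[of i] by (simp add: less_top)
    then obtain n :: nat where "emeasure N (S i) < of_nat n" using ennreal_Ex_less_of_nat by blast
    ultimately have "emeasure N (S i - U) \<le> of_nat n" by simp
    moreover have "S i - U \<in> sets N" "S i - U \<subseteq> space N - U" using S(1,2) Usets by blast+
    ultimately show ?thesis using null by blast
  qed
  then have "(\<Union>i. S i - U) \<in> null_sets N" using S(1) Usets by (intro null_sets_UN) auto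
  moreover have "(\<Union>i. S i - U) = space N - U" using S(2) by blast
  ultimately have "emeasure N (space N - U) = 0" by auto
  then have "emeasure N (space N) = emeasure N U"
    using plus_emeasure[of U N "space N - U"] Usets sets.sets_into_space[OF Usets]
    by (simp add: Un_absorb1)
  also have "\<dots> \<le> 1" using Us half1 by (auto simp: small_def intro: order_trans)
  finally show False using large by simp
qed

text \<open>
  The measure with density \<open>h\<close> is \<open>\<sigma>\<close>-finite, and it splits every set of positive finite measure: split
  the part of the set on which \<open>h\<close> is positive.
\<close>

lemma atomless_nn_integral_between:
  fixes h :: "'w \<Rightarrow> ennreal"
  assumes "sigma_finite_measure M" and atomless: "atomless M" and h[measurable]: "h \<in> borel_measurable M"
    and fin: "AE w in M. h w \<noteq> \<infinity>" and large: "1 < (\<integral>\<^sup>+w. h w \<partial>M)"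
  obtains B where "B \<in> sets M" "ennreal (1/2) \<le> (\<integral>\<^sup>+w. h w * indicator B w \<partial>M)"
    "(\<integral>\<^sup>+w. h w * indicator B w \<partial>M) \<le> 1"
proof -
  interpret sigma_finite_measure M by fact
  define N where "N = density M h"
  have N: "sets N = sets M" "space N = space M" by (simp_all add: N_def)
  have em: "emeasure N A = (\<integral>\<^sup>+w. h w * indicator A w \<partial>M)" if "A \<in> sets M" for A
    using that by (simp add: N_def emeasure_density)
  have nullN: "emeasure N A = 0 \<longleftrightarrow> (AE w in M. w \<in> A \<longrightarrow> h w = 0)" if A[measurable]: "A \<in> sets M" for A
  proof -
    have "emeasure N A = 0 \<longleftrightarrow> (AE w in M. h w * indicator A w = 0)"
      unfolding em[OF A] by (rule nn_integral_0_iff_AE) measurable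
    also have "\<dots> \<longleftrightarrow> (AE w in M. w \<in> A \<longrightarrow> h w = 0)"
      by (intro AE_cong) (auto simp: indicator_def)
    finally show ?thesis .
  qed
  have "\<exists>B\<in>sets N. ennreal (1/2) \<le> emeasure N B \<and> emeasure N B \<le> 1"
  proof (rule exists_subset_measure_between)
    show "sigma_finite_measure N" unfolding N_def using fin by (simp add: sigma_finite_iff_density_finite)
    have "emeasure N (space N) = (\<integral>\<^sup>+w. h w \<partial>M)"
      unfolding N(2) em[OF sets.top] by (intro nn_integral_cong) auto
    then show "1 < emeasure N (space N)" using large by simp
    fix A assume "A \<in> sets N" "0 < emeasure N A" "emeasure N A < \<infinity>"
    then have A[measurable]: "A \<in> sets M" and pos: "emeasure N A \<noteq> 0" and Afin: "emeasure N A < \<infinity>"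
      using N by auto
    define A' where "A' = {w\<in>space M. w \<in> A \<and> h w \<noteq> 0}"
    have A'[measurable]: "A' \<in> sets M" unfolding A'_def by measurable
    have "emeasure M A' \<noteq> 0"
    proof
      assume "emeasure M A' = 0"
      then have "AE w in M. w \<notin> A'" using A' by (intro AE_not_in null_setsI)
      then have "AE w in M. w \<in> A \<longrightarrow> h w = 0" by (rule AE_mp) (auto simp: A'_def)
      then show False using pos nullN[OF A] by simp
    qed
    then obtain B where B[measurable]: "B \<in> sets M" and B': "B \<subseteq> A'" "0 < emeasure M B" "emeasure M B < emeasure M A'"
      using atomless A' unfolding atomless_def by (auto simp: zero_less_iff_neq_zero)
    have posI: "emeasure N C \<noteq> 0" if C[measurable]: "C \<in> sets M" and "C \<subseteq> A'" "emeasure M C \<noteq> 0" for C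
    proof
      assume "emeasure N C = 0"
      then have "AE w in M. w \<in> C \<longrightarrow> h w = 0" using nullN[OF C] by simp
      then have "AE w in M. w \<notin> C" by (rule AE_mp) (use that(2) in \<open>auto simp: A'_def\<close>)
      then have "emeasure M C = 0" using AE_iff_null_sets[OF C] by auto
      with that(3) show False by simp
    qed
    have "emeasure M (A' - B) \<noteq> 0"
    proof
      assume "emeasure M (A' - B) = 0"
      then have "emeasure M A' = emeasure M B"
        using plus_emeasure[of B M "A' - B"] B'(1) by (simp add: Un_absorb1)
      with B'(3) show False by simp
    qed
    then have "emeasure N (A' - B) \<noteq> 0" by (intro posI) auto
    moreover have "emeasure N (A' - B) \<le> emeasure N (A - B)"
      using N by (intro emeasure_mono) (auto simp: A'_def)
    ultimately have "emeasure N (A - B) \<noteq> 0" by auto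
    moreover have BA: "B \<subseteq> A" using B'(1) by (auto simp: A'_def)
    moreover have "emeasure N B + emeasure N (A - B) = emeasure N A"
      using plus_emeasure[of B N "A - B"] BA N by (simp add: Un_absorb1)
    moreover have "emeasure N B \<noteq> \<infinity>"
      using Afin emeasure_mono[OF BA, of N] N by (metis A infinity_ennreal_def leD)
    moreover have "x < x + y" if "x \<noteq> \<infinity>" "y \<noteq> 0" for x y :: ennreal
      using that ennreal_add_left_cancel_less[of x 0 y] by (simp add: zero_less_iff_neq_zero)
    ultimately have "emeasure N B < emeasure N A" by metis
    moreover have "emeasure N B \<noteq> 0" using B' by (intro posI) auto
    ultimately show "\<exists>B\<in>sets N. B \<subseteq> A \<and> 0 < emeasure N B \<and> emeasure N B < emeasure N A"
      using BA N by (intro bexI[of _ B]) (auto simp: zero_less_iff_neq_zero)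
  qed
  then show ?thesis using that N(1) em by auto
qed

section \<open>From the minorant to the subderivative\<close>

text \<open>
  The minorant inequality at \<open>e = y / r\<close>, solved for the value at \<open>x0\<close>; here \<open>q\<close> stands for the pairing
  of \<open>x'\<close> with \<open>y\<close>, \<open>ph\<close> for \<open>\<phi> (y / r)\<close> and \<open>v\<close> for an integrable majorant of \<open>f\<close> along \<open>x0 + y\<close>.
\<close>

lemma minorant_pointwise:
  fixes fx fa ph :: ereal
  assumes "0 < r" "fx \<le> ereal v" "\<bar>fa\<bar> \<noteq> \<infinity>" "\<bar>ph\<bar> \<noteq> \<infinity>"
    and "ereal (inverse r) * (fx - fa) - ereal (q / r) \<ge> - (ereal \<epsilon> * ph) - ereal u"
  shows "fa \<le> ereal (v - q + r * \<epsilon> * real_of_ereal ph + r * u)"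
proof -
  obtain a where a: "fa = ereal a" using assms(3) by auto
  obtain b where b: "ph = ereal b" using assms(4) by auto
  obtain c where c: "fx = ereal c" using assms by (cases fx) (auto simp: a b)
  have "inverse r * (c - a) - q / r \<ge> - (\<epsilon> * b) - u" using assms(5) by (simp add: a b c)
  then have "r * (- (\<epsilon> * b) - u) \<le> r * (inverse r * (c - a) - q / r)"
    using assms(1) by (intro mult_left_mono) auto
  also have "\<dots> = (c - a) - q" using assms(1) by (simp add: field_simps)
  finally show ?thesis using assms(2) by (simp add: a b c algebra_simps)
qed

text \<open>
  The counterpart for the converse: the negated difference quotient exceeds \<open>\<epsilon> \<phi>\<close> by at least \<open>k\<close>, and
  this is solved for the value at the perturbed point; here \<open>q\<close> stands for the pairing of \<open>x'\<close> with \<open>e\<close>.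
\<close>

lemma gap_pointwise:
  fixes fz fa ph :: ereal
  assumes "0 < r" "\<bar>fa\<bar> \<noteq> \<infinity>" "fa \<le> ereal v" "\<bar>ph\<bar> \<noteq> \<infinity>"
    and "ereal k \<le> - (ereal (inverse r) * (fz - fa) - ereal q + ereal \<epsilon> * ph)"
  shows "fz \<le> ereal (v + r * q - r * \<epsilon> * real_of_ereal ph - r * k)"
proof -
  obtain a where a: "fa = ereal a" using assms(2) by auto
  obtain b where b: "ph = ereal b" using assms(4) by auto
  show ?thesis
  proof (cases fz)
    case (real c)
    have "k \<le> - (inverse r * (c - a) - q + \<epsilon> * b)" using assms(5) by (simp add: a b real)
    then have "r * k \<le> r * (- (inverse r * (c - a) - q + \<epsilon> * b))"
      using assms(1) by (intro mult_left_mono) auto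
    also have "\<dots> = r * q - (c - a) - r * \<epsilon> * b" using assms(1) by (simp add: field_simps)
    finally show ?thesis using assms(3) by (simp add: a b real algebra_simps)
  next
    case PInf
    then show ?thesis using assms(1,5) by (simp add: a b)
  qed simp
qed

locale frechet_setting = young_setting M \<phi> for M :: "'w measure" and \<phi> :: "'w \<Rightarrow> 'e::{banach, second_countable_topology} \<Rightarrow> ereal" +
  fixes f :: "'w \<Rightarrow> 'e \<Rightarrow> ereal" and x0 :: "'w \<Rightarrow> 'e" and x' :: "'w \<Rightarrow> ('e \<Rightarrow>\<^sub>L real)"
  assumes sigma_finite_M: "sigma_finite_measure M" and complete_M: "complete_measure M"
    and measurable_f: "measurable_integrand M f"
    and x0: "x0 \<in> orlicz_space M \<phi>"
    and finite_f_x0: "\<bar>int_functional M f x0\<bar> \<noteq> \<infinity>"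
    and x': "x' \<in> dual_orlicz_space M \<phi>"
begin

lemma measurable_x0[measurable]: "x0 \<in> borel_measurable M"
  using x0 by (rule orlicz_space_measurable)

lemma AE_f_x0_finite: "AE w in M. \<bar>f w (x0 w)\<bar> \<noteq> \<infinity>"
  using finite_f_x0 unfolding int_functional_def
  by (intro AE_finite_of_upper_integral_finite sigma_finite_M measurable_integrand_compose[OF measurable_f]) auto

lemma real_phi:
  assumes [measurable]: "x \<in> borel_measurable M" and le: "modular x < \<infinity>"
  shows "integrable M (\<lambda>w. real_of_ereal (\<phi> w (x w)))" "AE w in M. \<bar>\<phi> w (x w)\<bar> \<noteq> \<infinity>"
    "ennreal (\<integral>w. real_of_ereal (\<phi> w (x w)) \<partial>M) = modular x"
    "0 \<le> (\<integral>w. real_of_ereal (\<phi> w (x w)) \<partial>M)"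
proof -
  have nn: "\<forall>w\<in>space M. 0 \<le> \<phi> w (x w)" using phi_nonneg by blast
  note * = integrable_real_of_nonneg[OF measurable_phi_comp[OF assms(1)] nn le[unfolded modular_def]]
  show "integrable M (\<lambda>w. real_of_ereal (\<phi> w (x w)))" "AE w in M. \<bar>\<phi> w (x w)\<bar> \<noteq> \<infinity>" by (fact *)+
  show "ennreal (\<integral>w. real_of_ereal (\<phi> w (x w)) \<partial>M) = modular x" using *(3) by (simp add: modular_def)
  show "0 \<le> (\<integral>w. real_of_ereal (\<phi> w (x w)) \<partial>M)"
    using nn by (intro Bochner_Integration.integral_nonneg) (simp add: real_of_ereal_pos)
qed

text \<open>
  The scale is \<open>r = 2 \<parallel>x - x0\<parallel>\<close> rather than the norm itself, so that the modular of \<open>(x - x0) / r\<close> is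
  certainly at most \<open>1\<close>.  The error is then \<open>r (\<epsilon> + \<parallel>u\<^sub>r\<parallel>) \<le> 2 r \<epsilon>\<close>, which is \<open>\<eta> \<parallel>x - x0\<parallel>\<close> for
  \<open>\<epsilon> = \<eta> / 4\<close>.
\<close>

theorem frechet_subderivative_if_minorant:
  assumes cond: "frechet_minorant_condition M \<phi> f x' x0"
  shows "frechet_subderivative M \<phi> (int_functional M f) x' x0"
  unfolding frechet_subderivative_iff[where J="int_functional M f" and ?x0.0=x0, OF finite_f_x0 x0]
proof (intro allI impI)
  fix \<eta> :: real assume \<eta>: "0 < \<eta>"
  let ?J = "int_functional M f"
  let ?n = "\<lambda>x. orlicz_norm M \<phi> (\<lambda>w. x w - x0 w)"
  let ?p = "\<lambda>x. pairing M x' (\<lambda>w. x w - x0 w)"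
  define \<epsilon> where "\<epsilon> = \<eta> / 4"
  have \<epsilon>: "0 < \<epsilon>" using \<eta> by (simp add: \<epsilon>_def)
  have "\<exists>u :: real \<Rightarrow> 'w \<Rightarrow> real.
        (\<forall>r>0. \<forall>w\<in>space M. 0 \<le> u r w) \<and>
        (\<forall>\<^sub>F r in at_right 0. integrable M (u r)) \<and>
        ((\<lambda>r. \<integral>w. \<bar>u r w\<bar> \<partial>M) \<longlongrightarrow> 0) (at_right 0) \<and>
        (\<forall>\<^sub>F r in at_right 0.
           integrand_ge M (diff_quotient_integrand f x' x0 r)
             (\<lambda>w e. - (ereal \<epsilon> * scaled_integrand \<phi> 1 w e) - ereal (u r w)))"
    using cond \<epsilon> unfolding frechet_minorant_condition_def by simp
  then obtain u :: "real \<Rightarrow> 'w \<Rightarrow> real" where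
    u: "\<forall>\<^sub>F r in at_right 0. integrable M (u r)" "((\<lambda>r. \<integral>w. \<bar>u r w\<bar> \<partial>M) \<longlongrightarrow> 0) (at_right 0)"
      "\<forall>\<^sub>F r in at_right 0. integrand_ge M (diff_quotient_integrand f x' x0 r)
             (\<lambda>w e. - (ereal \<epsilon> * scaled_integrand \<phi> 1 w e) - ereal (u r w))"
    by (elim exE conjE)
  have "\<forall>\<^sub>F r in at_right 0. (\<integral>w. \<bar>u r w\<bar> \<partial>M) < \<epsilon>"
    using u(2) \<epsilon> by (rule order_tendstoD)
  with u(1,3) have "\<forall>\<^sub>F r in at_right 0. integrable M (u r) \<and> (\<integral>w. \<bar>u r w\<bar> \<partial>M) < \<epsilon> \<and>
     integrand_ge M (diff_quotient_integrand f x' x0 r)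
             (\<lambda>w e. - (ereal \<epsilon> * scaled_integrand \<phi> 1 w e) - ereal (u r w))"
    by (intro eventually_conj)
  then obtain \<rho> where \<rho>: "\<rho> > 0" "\<And>r. 0 < r \<Longrightarrow> r < \<rho> \<Longrightarrow> integrable M (u r) \<and> (\<integral>w. \<bar>u r w\<bar> \<partial>M) < \<epsilon> \<and>
     integrand_ge M (diff_quotient_integrand f x' x0 r)
             (\<lambda>w e. - (ereal \<epsilon> * scaled_integrand \<phi> 1 w e) - ereal (u r w))"
    unfolding eventually_at_right_field by blast
  have "?J x0 + ereal (?p x - \<eta> * ?n x) \<le> ?J x"
    if x: "x \<in> orlicz_space M \<phi>" and ne: "\<not> (AE w in M. x w = x0 w)" and small: "?n x < \<rho> / 2" for x
  proof -
    define y where "y = (\<lambda>w. x w - x0 w)"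
    have y: "y \<in> orlicz_space M \<phi>" unfolding y_def by (rule orlicz_space_diff[OF x x0])
    have ym[measurable]: "y \<in> borel_measurable M" using y by (rule orlicz_space_measurable)
    have "orlicz_norm M \<phi> y \<noteq> 0" using orlicz_norm_eq_0D[OF y] ne by (auto simp: y_def)
    then have n: "0 < orlicz_norm M \<phi> y" using orlicz_norm_nonneg[OF y] by simp
    define r where "r = 2 * orlicz_norm M \<phi> y"
    have r: "0 < r" "r < \<rho>" using n small by (auto simp: r_def y_def)
    note ur = \<rho>(2)[OF r, THEN conjunct1] \<rho>(2)[OF r, THEN conjunct2, THEN conjunct1]
      \<rho>(2)[OF r, THEN conjunct2, THEN conjunct2]
    have mod: "modular (\<lambda>w. inverse r *\<^sub>R y w) \<le> 1"
      by (rule modular_le_of_norm_less[OF y]) (use n in \<open>simp add: r_def\<close>)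
    then have mfin: "modular (\<lambda>w. inverse r *\<^sub>R y w) < \<infinity>" by (rule le_less_trans) simp
    have zm: "(\<lambda>w. inverse r *\<^sub>R y w) \<in> borel_measurable M" by measurable
    define \<Phi> where "\<Phi> w = real_of_ereal (\<phi> w (inverse r *\<^sub>R y w))" for w
    note ph = real_phi[OF zm mfin, folded \<Phi>_def]
    have ph1: "(\<integral>w. \<Phi> w \<partial>M) \<le> 1"
      using mod ph(3) by (metis ennreal_le_1)
    have py: "integrable M (\<lambda>w. blinfun_apply (x' w) (y w))" by (rule pairing_integrable[OF x' y])
    obtain j where j: "?J x0 = ereal j" using finite_f_x0 by auto
    show ?thesis
      unfolding int_functional_def[of M f x]
    proof (rule upper_integral_greatest)
      fix v assume v: "integrable M v" "AE w in M. f w (x w) \<le> ereal (v w)"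
      have "?J x0 \<le> ereal (\<integral>w. v w - blinfun_apply (x' w) (y w) + r * \<epsilon> * \<Phi> w + r * u r w \<partial>M)"
        unfolding int_functional_def
      proof (rule upper_integral_le)
        show "integrable M (\<lambda>w. v w - blinfun_apply (x' w) (y w) + r * \<epsilon> * \<Phi> w + r * u r w)"
          using v(1) py ph(1) ur(1) by auto
        from v(2) AE_f_x0_finite ph(2) ur(3)[unfolded integrand_ge_def]
        show "AE w in M. f w (x0 w) \<le> ereal (v w - blinfun_apply (x' w) (y w) + r * \<epsilon> * \<Phi> w + r * u r w)"
        proof eventually_elim
          case (elim w)
          have eq: "x0 w + r *\<^sub>R (inverse r *\<^sub>R y w) = x w" using r(1) by (simp add: y_def)
          have "- (ereal \<epsilon> * \<phi> w (inverse r *\<^sub>R y w)) - ereal (u r w)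
             \<le> ereal (inverse r) * (f w (x w) - f w (x0 w)) - ereal (blinfun_apply (x' w) (y w) / r)"
            using elim(4)[rule_format, of "inverse r *\<^sub>R y w"]
            by (simp only: diff_quotient_integrand_def scaled_integrand_def eq scaleR_one blinfun.scaleR_right)
               (simp add: divide_inverse mult.commute)
          from minorant_pointwise[OF r(1) elim(1,2,3) this] show ?case by (simp add: \<Phi>_def)
        qed
      qed
      also have "(\<integral>w. v w - blinfun_apply (x' w) (y w) + r * \<epsilon> * \<Phi> w + r * u r w \<partial>M) =
         (\<integral>w. v w \<partial>M) - ?p x + r * \<epsilon> * (\<integral>w. \<Phi> w \<partial>M) + r * (\<integral>w. u r w \<partial>M)"
        using v(1) py ph(1) ur(1) by (simp add: pairing_def y_def)
      finally have "j \<le> (\<integral>w. v w \<partial>M) - ?p x + r * \<epsilon> * (\<integral>w. \<Phi> w \<partial>M) + r * (\<integral>w. u r w \<partial>M)"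
        by (simp add: j)
      moreover have "r * \<epsilon> * (\<integral>w. \<Phi> w \<partial>M) \<le> r * \<epsilon> * 1"
        using r \<epsilon> ph1 by (intro mult_left_mono) auto
      moreover have "(\<integral>w. u r w \<partial>M) \<le> (\<integral>w. \<bar>u r w\<bar> \<partial>M)"
        using ur(1) by (intro integral_mono) auto
      then have "r * (\<integral>w. u r w \<partial>M) \<le> r * \<epsilon>"
        using r ur(2) by (intro mult_left_mono) auto
      moreover have "r * \<epsilon> + r * \<epsilon> = \<eta> * ?n x" by (simp add: r_def \<epsilon>_def y_def)
      ultimately show "?J x0 + ereal (?p x - \<eta> * ?n x) \<le> ereal (\<integral>w. v w \<partial>M)"
        unfolding j plus_ereal.simps ereal_less_eq by linarith
    qed
  qed
  then show "\<exists>d>0. \<forall>x\<in>orlicz_space M \<phi>. \<not> (AE w in M. x w = x0 w) \<longrightarrow> ?n x < d \<longrightarrow>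
      ?J x0 + ereal (?p x - \<eta> * ?n x) \<le> ?J x"
    using \<rho>(1) by (intro exI[of _ "\<rho> / 2"]) auto
qed

end

section \<open>From the subderivative to the minorant\<close>

context frechet_setting
begin

text \<open>
  The least admissible value of \<open>u r w\<close> at the point \<open>e\<close>.  It is written as the negation of a sum because
  of the convention \<open>\<infinity> + (- \<infinity>) = \<infinity>\<close>: the gap is \<open>- \<infinity>\<close> wherever \<open>\<phi>\<close> is infinite, and the minorant
  inequality is void there.
\<close>

definition gap :: "real \<Rightarrow> real \<Rightarrow> real \<Rightarrow> 'w \<Rightarrow> 'e \<Rightarrow> ereal" where
  "gap \<epsilon> l r w e = - (diff_quotient_integrand f x' x0 r w e + ereal \<epsilon> * scaled_integrand \<phi> l w e)"

lemma gap_zero: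
  assumes "w \<in> space M" "\<bar>f w (x0 w)\<bar> \<noteq> \<infinity>"
  shows "gap \<epsilon> l r w 0 = 0"
  using assms by (auto simp: gap_def diff_quotient_integrand_def scaled_integrand_def phi_zero)

lemma gap_finite_phi:
  assumes "ereal k \<le> gap \<epsilon> l r w e" "0 < \<epsilon>" "w \<in> space M"
  shows "\<bar>\<phi> w (l *\<^sub>R e)\<bar> \<noteq> \<infinity>"
  using assms phi_nonneg[of w "l *\<^sub>R e"]
  by (cases "\<phi> w (l *\<^sub>R e)") (auto simp: gap_def scaled_integrand_def)

lemma measurable_gap: "(\<lambda>(w, e). gap \<epsilon> l r w e) \<in> borel_measurable (M \<Otimes>\<^sub>M borel)"
proof -
  have sm: "scalarly_measurable M x'" using x' by (simp add: dual_orlicz_space_def)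
  have 1: "(\<lambda>p. f (fst p) (x0 (fst p) + r *\<^sub>R snd p)) \<in> borel_measurable (M \<Otimes>\<^sub>M borel)"
  proof -
    have "(\<lambda>p. (fst p, x0 (fst p) + r *\<^sub>R snd p)) \<in> measurable (M \<Otimes>\<^sub>M borel) (M \<Otimes>\<^sub>M borel)" by measurable
    from measurable_compose[OF this measurable_f[unfolded measurable_integrand_def]] show ?thesis by simp
  qed
  have 2: "(\<lambda>p. f (fst p) (x0 (fst p))) \<in> borel_measurable (M \<Otimes>\<^sub>M (borel :: 'e measure))"
    by (rule measurable_compose[OF measurable_fst measurable_integrand_compose[OF measurable_f measurable_x0]])
  have 3: "(\<lambda>p. \<phi> (fst p) (l *\<^sub>R snd p)) \<in> borel_measurable (M \<Otimes>\<^sub>M borel)"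
  proof -
    have "(\<lambda>p. (fst p, l *\<^sub>R snd p)) \<in> measurable (M \<Otimes>\<^sub>M borel) (M \<Otimes>\<^sub>M (borel :: 'e measure))" by measurable
    from measurable_compose[OF this measurable_phi[unfolded measurable_integrand_def]] show ?thesis by simp
  qed
  have 4: "(\<lambda>p. blinfun_apply (x' (fst p)) (snd p)) \<in> borel_measurable (M \<Otimes>\<^sub>M borel)"
    using measurable_scalar_pairing[OF sm] by (simp add: case_prod_beta')
  note [measurable] = 1 2 3 4
  show ?thesis
    unfolding gap_def diff_quotient_integrand_def scaled_integrand_def case_prod_beta' by measurable
qed

text \<open>
  The estimate extends to the class of \<open>x0\<close>, on which the functional is constant and the pairing vanishes.
\<close>

lemma frechet_lower_bound:
  assumes frechet: "frechet_subderivative M \<phi> (int_functional M f) x' x0" and "0 < \<eta>"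
  obtains d where "0 < d" "\<And>z. z \<in> orlicz_space M \<phi> \<Longrightarrow> orlicz_norm M \<phi> (\<lambda>w. z w - x0 w) < d \<Longrightarrow>
    int_functional M f x0 + ereal (pairing M x' (\<lambda>w. z w - x0 w) - \<eta> * orlicz_norm M \<phi> (\<lambda>w. z w - x0 w))
      \<le> int_functional M f z"
proof -
  let ?J = "int_functional M f"
  let ?n = "\<lambda>x. orlicz_norm M \<phi> (\<lambda>w. x w - x0 w)"
  let ?p = "\<lambda>x. pairing M x' (\<lambda>w. x w - x0 w)"
  have "\<forall>\<eta>>0. \<exists>d>0. \<forall>x\<in>orlicz_space M \<phi>. \<not> (AE w in M. x w = x0 w) \<longrightarrow> ?n x < d \<longrightarrow>
      ?J x0 + ereal (?p x - \<eta> * ?n x) \<le> ?J x"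
    using frechet frechet_subderivative_iff[where J="int_functional M f" and ?x0.0=x0 and x'=x', OF finite_f_x0 x0]
    by (simp only:)
  then obtain d where d: "0 < d" "\<And>x. x \<in> orlicz_space M \<phi> \<Longrightarrow> \<not> (AE w in M. x w = x0 w) \<Longrightarrow> ?n x < d \<Longrightarrow>
      ?J x0 + ereal (?p x - \<eta> * ?n x) \<le> ?J x"
    using \<open>0 < \<eta>\<close> by meson
  show ?thesis
  proof (rule that[OF d(1)])
    fix z assume z: "z \<in> orlicz_space M \<phi>" "?n z < d"
    show "?J x0 + ereal (?p z - \<eta> * ?n z) \<le> ?J z"
    proof (cases "AE w in M. z w = x0 w")
      case True
      have "?J z = ?J x0" unfolding int_functional_def
        by (rule upper_integral_cong_AE, rule AE_mp[OF True]) simp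
      moreover have "?p z = 0"
      proof -
        have "?p z = (\<integral>w. 0 \<partial>M)" unfolding pairing_def
        proof (rule integral_cong_AE)
          show "(\<lambda>w. blinfun_apply (x' w) (z w - x0 w)) \<in> borel_measurable M"
            by (rule borel_measurable_integrable[OF pairing_integrable[OF x' orlicz_space_diff[OF z(1) x0]]])
          show "AE w in M. blinfun_apply (x' w) (z w - x0 w) = 0"
            using True by (rule AE_mp) simp
        qed simp
        then show ?thesis by simp
      qed
      moreover have "0 \<le> \<eta> * ?n z"
        using orlicz_norm_nonneg[OF orlicz_space_diff[OF z(1) x0]] \<open>0 < \<eta>\<close> by simp
      moreover obtain j where "?J x0 = ereal j" using finite_f_x0 by auto
      ultimately show ?thesis by simp
    next
      case False
      with d(2) z show ?thesis by blast
    qed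
  qed
qed

text \<open>
  The subderivative inequality at \<open>x0 + r e\<close>, whose distance to \<open>x0\<close> is at most \<open>r / l\<close>.  A majorant
  \<open>v\<close> of \<open>f\<close> along \<open>x0\<close> with nearly minimal integral gives a majorant along \<open>x0 + r e\<close>, smaller by
  \<open>r (k + \<epsilon> \<phi> (l e))\<close> up to the linear term; comparison with the lower bound gives the estimate.
\<close>

lemma gap_estimate_modular_le_1:
  assumes lb: "\<And>z. z \<in> orlicz_space M \<phi> \<Longrightarrow> orlicz_norm M \<phi> (\<lambda>w. z w - x0 w) < d \<Longrightarrow>
    int_functional M f x0 + ereal (pairing M x' (\<lambda>w. z w - x0 w) - \<eta> * orlicz_norm M \<phi> (\<lambda>w. z w - x0 w))
      \<le> int_functional M f z"
    and pos: "0 < \<eta>" "0 < \<epsilon>" "0 < l" "0 < r" "r < l * d"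
    and e[measurable]: "e \<in> borel_measurable M" and mod: "modular (\<lambda>w. l *\<^sub>R e w) \<le> 1"
    and k: "integrable M k" "AE w in M. ereal (k w) \<le> gap \<epsilon> l r w (e w)"
  shows "(\<integral>w. k w \<partial>M) + \<epsilon> * (\<integral>w. real_of_ereal (\<phi> w (l *\<^sub>R e w)) \<partial>M) \<le> \<eta> / l"
proof -
  define y where "y = (\<lambda>w. r *\<^sub>R e w)"
  have ym[measurable]: "y \<in> borel_measurable M" by (simp add: y_def)
  have "inverse (r / l) *\<^sub>R y w = l *\<^sub>R e w" for w using pos by (simp add: y_def)
  then have mody: "modular (\<lambda>w. inverse (r / l) *\<^sub>R y w) \<le> 1" using mod by simp
  have rl: "0 < r / l" using pos by simp
  have y: "y \<in> orlicz_space M \<phi>" using mody rl ym orlicz_space_iff by blast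
  have ny: "orlicz_norm M \<phi> y \<le> r / l" by (rule orlicz_norm_le[OF ym rl mody])
  have "(\<lambda>w. x0 w + y w) \<in> orlicz_space M \<phi>" by (rule orlicz_space_add[OF x0 y])
  moreover have "orlicz_norm M \<phi> y < d"
  proof -
    have "r / l < d" using pos by (simp add: field_simps)
    with ny show ?thesis by linarith
  qed
  ultimately have J: "int_functional M f x0 + ereal (pairing M x' y - \<eta> * orlicz_norm M \<phi> y)
      \<le> int_functional M f (\<lambda>w. x0 w + y w)"
    using lb[of "\<lambda>w. x0 w + y w"] by simp
  have lem: "(\<lambda>w. l *\<^sub>R e w) \<in> borel_measurable M" by measurable
  have mfin: "modular (\<lambda>w. l *\<^sub>R e w) < \<infinity>" using mod by (rule le_less_trans) simp
  define \<Phi> where "\<Phi> w = real_of_ereal (\<phi> w (l *\<^sub>R e w))" for w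
  note ph = real_phi[OF lem mfin, folded \<Phi>_def]
  have py: "integrable M (\<lambda>w. blinfun_apply (x' w) (y w))" by (rule pairing_integrable[OF x' y])
  obtain j where j: "int_functional M f x0 = ereal j" using finite_f_x0 by auto
  have "r * ((\<integral>w. k w \<partial>M) + \<epsilon> * (\<integral>w. \<Phi> w \<partial>M)) \<le> \<eta> * (r / l)"
  proof (rule field_le_epsilon)
    fix \<kappa> :: real assume "0 < \<kappa>"
    then have "upper_integral M (\<lambda>w. f w (x0 w)) < ereal (j + \<kappa>)"
      using j by (simp add: int_functional_def)
    then obtain v where v: "integrable M v" "AE w in M. f w (x0 w) \<le> ereal (v w)" "ereal (\<integral>w. v w \<partial>M) < ereal (j + \<kappa>)"
      by (rule upper_integral_less_obtain)
    have "int_functional M f (\<lambda>w. x0 w + y w) \<le>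
       ereal (\<integral>w. v w + blinfun_apply (x' w) (y w) - r * \<epsilon> * \<Phi> w - r * k w \<partial>M)"
      unfolding int_functional_def
    proof (rule upper_integral_le)
      show "integrable M (\<lambda>w. v w + blinfun_apply (x' w) (y w) - r * \<epsilon> * \<Phi> w - r * k w)"
        using v(1) py ph(1) k(1) by auto
      from v(2) AE_f_x0_finite ph(2) k(2)
      show "AE w in M. f w (x0 w + y w) \<le> ereal (v w + blinfun_apply (x' w) (y w) - r * \<epsilon> * \<Phi> w - r * k w)"
      proof eventually_elim
        case (elim w)
        have "ereal (k w) \<le> - (ereal (inverse r) * (f w (x0 w + y w) - f w (x0 w)) -
            ereal (blinfun_apply (x' w) (e w)) + ereal \<epsilon> * \<phi> w (l *\<^sub>R e w))"
          using elim(4) by (simp only: gap_def diff_quotient_integrand_def scaled_integrand_def y_def)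
        from gap_pointwise[OF pos(4) elim(2,1,3) this]
        show ?case by (simp add: \<Phi>_def y_def blinfun.scaleR_right)
      qed
    qed
    also have "(\<integral>w. v w + blinfun_apply (x' w) (y w) - r * \<epsilon> * \<Phi> w - r * k w \<partial>M) =
       (\<integral>w. v w \<partial>M) + pairing M x' y - r * \<epsilon> * (\<integral>w. \<Phi> w \<partial>M) - r * (\<integral>w. k w \<partial>M)"
      using v(1) py ph(1) k(1) by (simp add: pairing_def)
    finally have "int_functional M f (\<lambda>w. x0 w + y w) \<le> ereal ((\<integral>w. v w \<partial>M) + pairing M x' y - r * \<epsilon> * (\<integral>w. \<Phi> w \<partial>M) - r * (\<integral>w. k w \<partial>M))" .
    with J have "j + (pairing M x' y - \<eta> * orlicz_norm M \<phi> y) \<le>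
       (\<integral>w. v w \<partial>M) + pairing M x' y - r * \<epsilon> * (\<integral>w. \<Phi> w \<partial>M) - r * (\<integral>w. k w \<partial>M)"
      unfolding j plus_ereal.simps by (meson ereal_less_eq(3) order_trans)
    moreover have "\<eta> * orlicz_norm M \<phi> y \<le> \<eta> * (r / l)" using ny pos by (intro mult_left_mono) auto
    moreover have "(\<integral>w. v w \<partial>M) < j + \<kappa>" using v(3) by simp
    ultimately show "r * ((\<integral>w. k w \<partial>M) + \<epsilon> * (\<integral>w. \<Phi> w \<partial>M)) \<le> \<eta> * (r / l) + \<kappa>"
      by (simp add: algebra_simps)
  qed
  also have "\<eta> * (r / l) = r * (\<eta> / l)" by simp
  finally show ?thesis unfolding mult_le_cancel_left_pos[OF pos(4)] \<Phi>_def .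
qed

text \<open>
  Where there are no atoms, a function \<open>l e\<close> of modular larger than \<open>1\<close> can be cut off to a set \<open>B\<close> on
  which its modular is between \<open>1/2\<close> and \<open>1\<close>.  The cut-off function has gap \<open>0\<close> outside \<open>B\<close>, so the
  previous estimate applies to it and yields \<open>\<epsilon> / 2 \<le> \<eta> / l\<close>, which the choice of \<open>\<eta>\<close> excludes.
\<close>

lemma gap_estimate:
  assumes atomless: "atomless M"
    and lb: "\<And>z. z \<in> orlicz_space M \<phi> \<Longrightarrow> orlicz_norm M \<phi> (\<lambda>w. z w - x0 w) < d \<Longrightarrow>
    int_functional M f x0 + ereal (pairing M x' (\<lambda>w. z w - x0 w) - \<eta> * orlicz_norm M \<phi> (\<lambda>w. z w - x0 w))
      \<le> int_functional M f z"
    and pos: "0 < \<eta>" "0 < \<epsilon>" "0 < l" "0 < r" "r < l * d" and \<eta>: "\<eta> < \<epsilon> * l / 2"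
    and e[measurable]: "e \<in> borel_measurable M"
    and k: "integrable M k" "\<And>w. 0 \<le> k w" "AE w in M. ereal (k w) \<le> gap \<epsilon> l r w (e w)"
  shows "(\<integral>w. k w \<partial>M) \<le> \<eta> / l"
proof -
  have lem: "(\<lambda>w. l *\<^sub>R e w) \<in> borel_measurable M" by measurable
  have "modular (\<lambda>w. l *\<^sub>R e w) \<le> 1"
  proof (rule ccontr)
    assume "\<not> modular (\<lambda>w. l *\<^sub>R e w) \<le> 1"
    then have large: "1 < (\<integral>\<^sup>+w. e2ennreal (\<phi> w (l *\<^sub>R e w)) \<partial>M)" by (simp add: modular_def)
    have hm: "(\<lambda>w. e2ennreal (\<phi> w (l *\<^sub>R e w))) \<in> borel_measurable M"
      using measurable_phi_comp[OF lem] by simp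
    have "AE w in M. e2ennreal (\<phi> w (l *\<^sub>R e w)) \<noteq> \<infinity>"
      using k(3)
    proof (rule AE_mp, intro AE_I2 impI)
      fix w assume "w \<in> space M" "ereal (k w) \<le> gap \<epsilon> l r w (e w)"
      then have "\<bar>\<phi> w (l *\<^sub>R e w)\<bar> \<noteq> \<infinity>" by (intro gap_finite_phi[OF _ pos(2)])
      then show "e2ennreal (\<phi> w (l *\<^sub>R e w)) \<noteq> \<infinity>" by (cases "\<phi> w (l *\<^sub>R e w)") auto
    qed
    from atomless_nn_integral_between[OF sigma_finite_M atomless hm this large]
    obtain B where B[measurable]: "B \<in> sets M"
      and ge: "ennreal (1/2) \<le> (\<integral>\<^sup>+w. e2ennreal (\<phi> w (l *\<^sub>R e w)) * indicator B w \<partial>M)"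
      and le: "(\<integral>\<^sup>+w. e2ennreal (\<phi> w (l *\<^sub>R e w)) * indicator B w \<partial>M) \<le> 1" by metis
    define e' where "e' w = indicator B w *\<^sub>R e w" for w
    have e'm[measurable]: "e' \<in> borel_measurable M" unfolding e'_def by measurable
    have mod_eq: "modular (\<lambda>w. l *\<^sub>R e' w) = (\<integral>\<^sup>+w. e2ennreal (\<phi> w (l *\<^sub>R e w)) * indicator B w \<partial>M)"
      unfolding modular_def
      by (intro nn_integral_cong) (auto simp: e'_def indicator_def phi_zero e2ennreal_neg)
    have le1: "modular (\<lambda>w. l *\<^sub>R e' w) \<le> 1" using le by (simp only: mod_eq)
    define k' where "k' w = k w * indicator B w" for w
    have k'i: "integrable M k'" unfolding k'_def using k(1) B by (rule integrable_real_mult_indicator[rotated])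
    have "AE w in M. ereal (k' w) \<le> gap \<epsilon> l r w (e' w)"
      using AE_conjI[OF k(3) AE_f_x0_finite]
      by (rule AE_mp) (auto simp: k'_def e'_def indicator_def gap_zero)
    from gap_estimate_modular_le_1[OF lb pos e'm le1 k'i this]
    have est: "(\<integral>w. k' w \<partial>M) + \<epsilon> * (\<integral>w. real_of_ereal (\<phi> w (l *\<^sub>R e' w)) \<partial>M) \<le> \<eta> / l" by simp
    have le'm: "(\<lambda>w. l *\<^sub>R e' w) \<in> borel_measurable M" by measurable
    have "modular (\<lambda>w. l *\<^sub>R e' w) < \<infinity>" using le1 by (rule le_less_trans) simp
    note ph = real_phi[OF le'm this]
    have "ennreal (1/2) \<le> ennreal (\<integral>w. real_of_ereal (\<phi> w (l *\<^sub>R e' w)) \<partial>M)"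
      using ge by (simp only: ph(3) mod_eq)
    then have "1/2 \<le> (\<integral>w. real_of_ereal (\<phi> w (l *\<^sub>R e' w)) \<partial>M)"
      using ph(4) by (subst (asm) ennreal_le_iff) auto
    then have "\<epsilon> * (1/2) \<le> \<epsilon> * (\<integral>w. real_of_ereal (\<phi> w (l *\<^sub>R e' w)) \<partial>M)"
      using pos by (intro mult_left_mono) auto
    moreover have "0 \<le> (\<integral>w. k' w \<partial>M)" using k(2) by (intro Bochner_Integration.integral_nonneg) (simp add: k'_def)
    moreover have "\<eta> / l < \<epsilon> / 2" using \<eta> pos by (simp add: field_simps)
    ultimately show False using est by linarith
  qed
  note est = gap_estimate_modular_le_1[OF lb pos e this k(1,3)]
  have "modular (\<lambda>w. l *\<^sub>R e w) < \<infinity>" using \<open>modular (\<lambda>w. l *\<^sub>R e w) \<le> 1\<close> by (rule le_less_trans) simp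
  from real_phi(4)[OF lem this] have "0 \<le> \<epsilon> * (\<integral>w. real_of_ereal (\<phi> w (l *\<^sub>R e w)) \<partial>M)"
    using pos by simp
  with est show ?thesis by simp
qed

definition excess :: "real \<Rightarrow> real \<Rightarrow> real \<Rightarrow> 'w \<Rightarrow> ereal" where
  "excess \<epsilon> l r w = max 0 (SUP e. gap \<epsilon> l r w e)"

text \<open>
  The set where the supremum exceeds \<open>c\<close> is the projection of a product measurable set.
\<close>

lemma measurable_excess: "excess \<epsilon> l r \<in> borel_measurable M"
proof -
  have "(\<lambda>w. SUP e. gap \<epsilon> l r w e) \<in> borel_measurable M"
  proof (rule borel_measurableI_greater)
    fix c
    define A where "A = {p \<in> space (M \<Otimes>\<^sub>M (borel :: 'e measure)). c < (case p of (w, e) \<Rightarrow> gap \<epsilon> l r w e)}"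
    have "A \<in> sets (M \<Otimes>\<^sub>M borel)"
      unfolding A_def by (rule borel_measurable_less[OF measurable_const measurable_gap]) simp
    from measurable_selection[OF sigma_finite_M complete_M this]
    have "fst ` A \<in> sets M" by metis
    moreover have "{w \<in> space M. c < (SUP e. gap \<epsilon> l r w e)} = fst ` A"
      by (force simp: A_def less_SUP_iff space_pair_measure)
    ultimately show "{w \<in> space M. c < (SUP e. gap \<epsilon> l r w e)} \<in> sets M" by simp
  qed
  then show ?thesis unfolding excess_def[abs_def] by measurable
qed

text \<open>
  The excess is the limit of integrable functions \<open>k n\<close> that lie strictly below it wherever it is
  positive.  Strictness makes the set of \<open>e\<close> with gap larger than \<open>k n\<close> nonempty at these points, so a
  measurable selection exists; with \<open>e = 0\<close> elsewhere it is admissible in the estimate above.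
\<close>

lemma nn_integral_excess_le:
  assumes atomless: "atomless M"
    and lb: "\<And>z. z \<in> orlicz_space M \<phi> \<Longrightarrow> orlicz_norm M \<phi> (\<lambda>w. z w - x0 w) < d \<Longrightarrow>
    int_functional M f x0 + ereal (pairing M x' (\<lambda>w. z w - x0 w) - \<eta> * orlicz_norm M \<phi> (\<lambda>w. z w - x0 w))
      \<le> int_functional M f z"
    and pos: "0 < \<eta>" "0 < \<epsilon>" "0 < l" "0 < r" "r < l * d" and \<eta>: "\<eta> < \<epsilon> * l / 2"
  shows "(\<integral>\<^sup>+w. e2ennreal (excess \<epsilon> l r w) \<partial>M) \<le> ennreal (\<eta> / l)"
proof -
  interpret sigma_finite_measure M by (rule sigma_finite_M)
  obtain p :: "'w \<Rightarrow> real" where p[measurable]: "p \<in> borel_measurable M" and p0: "\<And>w. 0 < p w" and pint: "integrable M p"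
    by (rule obtain_positive_integrable_function, rule that)
  note [measurable] = measurable_excess
  \<comment> \<open>the factor below one gives strictness where the excess is finite, the truncation by a multiple of \<open>p\<close> gives integrability\<close>
  define m where "m n w = min (ereal (1 - inverse (real (Suc n))) * excess \<epsilon> l r w) (ereal (real n * p w))" for n w
  define k where "k n w = real_of_ereal (m n w)" for n w
  have c0: "0 \<le> 1 - inverse (real (Suc n))" for n by (simp add: field_simps)
  have ex0: "0 \<le> excess \<epsilon> l r w" for w by (simp add: excess_def)
  have m0: "0 \<le> m n w" for n w
    using ex0[of w] p0[of w] c0[of n] by (auto simp: m_def min_def less_imp_le)
  have mle: "m n w \<le> ereal (real n * p w)" for n w by (simp add: m_def)
  have mk: "m n w = ereal (k n w)" for n w
    using m0[of n w] mle[of n w] by (cases "m n w") (auto simp: k_def)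
  have k0: "0 \<le> k n w" for n w using m0[of n w] by (simp add: mk)
  have km[measurable]: "k n \<in> borel_measurable M" for n unfolding k_def m_def by measurable
  have kint: "integrable M (k n)" for n
  proof (rule Bochner_Integration.integrable_bound)
    show "integrable M (\<lambda>w. real n * p w)" using pint by simp
    have "norm (k n w) \<le> norm (real n * p w)" for w
      using mle[of n w] k0[of n w] by (simp add: mk)
    then show "AE w in M. norm (k n w) \<le> norm (real n * p w)" by simp
  qed measurable
  have kless: "ereal (k n w) < excess \<epsilon> l r w" if "0 < excess \<epsilon> l r w" for n w
  proof (cases "excess \<epsilon> l r w")
    case (real x)
    have "m n w \<le> ereal ((1 - inverse (real (Suc n))) * x)" by (simp add: m_def real)
    also have "\<dots> < ereal (1 * x)"
      unfolding less_ereal.simps using that by (intro mult_strict_right_mono) (auto simp: real)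
    finally show ?thesis by (simp add: mk real)
  qed (use that in auto)
  have bound: "(\<integral>w. k n w \<partial>M) \<le> \<eta> / l" for n
  proof -
    define A where "A = {q \<in> space (M \<Otimes>\<^sub>M (borel :: 'e measure)). ereal (k n (fst q)) < (case q of (w, e) \<Rightarrow> gap \<epsilon> l r w e)}"
    have "A \<in> sets (M \<Otimes>\<^sub>M borel)"
      unfolding A_def by (rule borel_measurable_less[OF _ measurable_gap]) measurable
    from measurable_selection[OF sigma_finite_M complete_M this]
    obtain s where s[measurable]: "s \<in> borel_measurable M" and sA: "AE w in M. w \<in> fst ` A \<longrightarrow> (w, s w) \<in> A" by metis
    define e where "e w = (if 0 < excess \<epsilon> l r w then s w else 0)" for w
    have em: "e \<in> borel_measurable M" unfolding e_def by measurable
    have "AE w in M. ereal (k n w) \<le> gap \<epsilon> l r w (e w)"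
      using AE_conjI[OF sA AE_f_x0_finite]
    proof (rule AE_mp, intro AE_I2 impI)
      fix w assume w: "w \<in> space M" "(w \<in> fst ` A \<longrightarrow> (w, s w) \<in> A) \<and> \<bar>f w (x0 w)\<bar> \<noteq> \<infinity>"
      show "ereal (k n w) \<le> gap \<epsilon> l r w (e w)"
      proof (cases "0 < excess \<epsilon> l r w")
        case True
        have "ereal (k n w) < (SUP e. gap \<epsilon> l r w e)"
          using kless[OF True, of n] k0[of n w] True by (auto simp: excess_def max_def split: if_splits)
        then obtain e0 where "ereal (k n w) < gap \<epsilon> l r w e0" by (auto simp: less_SUP_iff)
        then have "(w, e0) \<in> A" using w(1) by (simp add: A_def space_pair_measure)
        then have "w \<in> fst ` A" by force
        then have "(w, s w) \<in> A" using w(2) by blast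
        then show ?thesis using True by (simp add: A_def e_def less_imp_le)
      next
        case False
        then have "excess \<epsilon> l r w = 0" using ex0[of w] by simp
        then have "m n w \<le> 0" by (simp add: m_def min.coboundedI1)
        then have "k n w \<le> 0" by (simp add: mk)
        moreover have "gap \<epsilon> l r w (e w) = 0" using False gap_zero w by (simp add: e_def)
        ultimately show ?thesis by simp
      qed
    qed
    from gap_estimate[OF atomless lb pos \<eta> em kint k0 this] show ?thesis by simp
  qed
  have lim: "(\<lambda>n. ennreal (k n w)) \<longlonglongrightarrow> e2ennreal (excess \<epsilon> l r w)" for w
  proof -
    have np: "filterlim (\<lambda>n. real n * p w) at_top sequentially"
      using p0[of w] by (intro filterlim_at_top_mult_tendsto_pos[OF tendsto_const] filterlim_real_sequentially)
    have "(\<lambda>n. m n w) \<longlonglongrightarrow> excess \<epsilon> l r w"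
    proof (cases "excess \<epsilon> l r w")
      case (real x)
      have "\<forall>\<^sub>F n in sequentially. x \<le> real n * p w" using np by (simp add: filterlim_at_top)
      then have "\<forall>\<^sub>F n in sequentially. ereal ((1 - inverse (real (Suc n))) * x) = m n w"
      proof eventually_elim
        case (elim n)
        have "0 \<le> x" using ex0[of w] real by simp
        then have "(1 - inverse (real (Suc n))) * x \<le> 1 * x" by (intro mult_right_mono) auto
        then show ?case using elim by (simp add: m_def real min_def)
      qed
      moreover have "(\<lambda>n. ereal ((1 - inverse (real (Suc n))) * x)) \<longlonglongrightarrow> ereal ((1 - 0) * x)"
        by (intro tendsto_intros LIMSEQ_inverse_real_of_nat)
      ultimately have "(\<lambda>n. m n w) \<longlonglongrightarrow> ereal ((1 - 0) * x)" by (rule Lim_transform_eventually[rotated])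
      then show ?thesis by (simp add: real)
    next
      case PInf
      have "\<forall>\<^sub>F n in sequentially. ereal (real n * p w) = m n w"
        using eventually_gt_at_top[of 0]
        by eventually_elim (auto simp: m_def PInf min_def field_simps)
      moreover have "(\<lambda>n. ereal (real n * p w)) \<longlonglongrightarrow> \<infinity>"
        using np by (simp add: tendsto_PInfty_eq_at_top)
      ultimately have "(\<lambda>n. m n w) \<longlonglongrightarrow> \<infinity>" by (rule Lim_transform_eventually[rotated])
      then show ?thesis by (simp add: PInf)
    qed (use ex0[of w] in simp)
    from tendsto_e2ennrealI[OF this] show ?thesis by (simp add: mk)
  qed
  have "(\<integral>\<^sup>+w. e2ennreal (excess \<epsilon> l r w) \<partial>M) = (\<integral>\<^sup>+w. liminf (\<lambda>n. ennreal (k n w)) \<partial>M)"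
    by (intro nn_integral_cong lim_imp_Liminf[symmetric] lim) simp
  also have "\<dots> \<le> liminf (\<lambda>n. \<integral>\<^sup>+w. ennreal (k n w) \<partial>M)"
    by (rule nn_integral_liminf) measurable
  also have "\<dots> \<le> liminf (\<lambda>n::nat. ennreal (\<eta> / l))"
  proof (rule Liminf_mono, rule always_eventually, rule allI)
    fix n
    have "(\<integral>\<^sup>+w. ennreal (k n w) \<partial>M) = ennreal (\<integral>w. k n w \<partial>M)"
      using k0 by (intro nn_integral_eq_integral kint) auto
    also have "\<dots> \<le> ennreal (\<eta> / l)" by (intro ennreal_leI bound)
    finally show "(\<integral>\<^sup>+w. ennreal (k n w) \<partial>M) \<le> ennreal (\<eta> / l)" .
  qed
  also have "\<dots> = ennreal (\<eta> / l)" by (simp add: Liminf_const)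
  finally show ?thesis .
qed

text \<open>
  The excess itself serves as \<open>u\<close>: its integral is at most \<open>\<eta> / l\<close> for all small \<open>r\<close>, where \<open>\<eta>\<close> is
  arbitrarily small.
\<close>

theorem minorant_if_frechet_subderivative:
  assumes atomless: "atomless M" and frechet: "frechet_subderivative M \<phi> (int_functional M f) x' x0"
  shows "frechet_minorant_condition M \<phi> f x' x0"
  unfolding frechet_minorant_condition_def
proof (intro allI impI)
  fix \<epsilon> l :: real assume \<epsilon>: "0 < \<epsilon>" and l: "0 < l"
  define u where "u r = (\<lambda>w. real_of_ereal (excess \<epsilon> l r w))" for r
  have ex0: "\<forall>w\<in>space M. 0 \<le> excess \<epsilon> l r w" for r by (simp add: excess_def)
  have small: "\<forall>\<^sub>F r in at_right 0. 0 < r \<and> (\<integral>\<^sup>+w. e2ennreal (excess \<epsilon> l r w) \<partial>M) \<le> ennreal (\<eta> / l)"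
    if \<eta>: "0 < \<eta>" "\<eta> < \<epsilon> * l / 2" for \<eta>
  proof -
    obtain d where d: "0 < d" "\<And>z. z \<in> orlicz_space M \<phi> \<Longrightarrow> orlicz_norm M \<phi> (\<lambda>w. z w - x0 w) < d \<Longrightarrow>
      int_functional M f x0 + ereal (pairing M x' (\<lambda>w. z w - x0 w) - \<eta> * orlicz_norm M \<phi> (\<lambda>w. z w - x0 w))
      \<le> int_functional M f z"
      by (rule frechet_lower_bound[OF frechet \<eta>(1)], rule that)
    have "0 < l * d" using l d by simp
    then show ?thesis unfolding eventually_at_right_field
      using nn_integral_excess_le[OF atomless d(2) \<eta>(1) \<epsilon> l _ _ \<eta>(2)] by blast
  qed
  have conseq: "integrable M (u r) \<and> (\<integral>w. \<bar>u r w\<bar> \<partial>M) \<le> c \<and> (AE w in M. \<bar>excess \<epsilon> l r w\<bar> \<noteq> \<infinity>)"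
    if "(\<integral>\<^sup>+w. e2ennreal (excess \<epsilon> l r w) \<partial>M) \<le> ennreal c" "0 < c" for r c
  proof -
    have "(\<integral>\<^sup>+w. e2ennreal (excess \<epsilon> l r w) \<partial>M) < \<infinity>" using that(1) by (rule le_less_trans) simp
    note * = integrable_real_of_nonneg[OF measurable_excess ex0 this]
    have "\<bar>u r w\<bar> = u r w" for w by (simp add: u_def excess_def real_of_ereal_pos)
    moreover have "(\<integral>w. u r w \<partial>M) \<le> c"
      using that *(3) by (simp add: u_def ennreal_le_iff flip: ennreal_le_iff)
    ultimately show ?thesis using *(1,2) by (simp add: u_def)
  qed
  define \<eta>0 where "\<eta>0 = \<epsilon> * l / 4"
  have \<eta>0: "0 < \<eta>0" "\<eta>0 < \<epsilon> * l / 2" using \<epsilon> l by (auto simp: \<eta>0_def)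
  have ev: "\<forall>\<^sub>F r in at_right 0. integrable M (u r) \<and> (AE w in M. \<bar>excess \<epsilon> l r w\<bar> \<noteq> \<infinity>)"
    using small[OF \<eta>0] by eventually_elim (use conseq \<eta>0 l in auto)
  have lim: "((\<lambda>r. \<integral>w. \<bar>u r w\<bar> \<partial>M) \<longlongrightarrow> 0) (at_right 0)"
  proof (rule tendstoI)
    fix \<delta> :: real assume \<delta>: "0 < \<delta>"
    define \<eta> where "\<eta> = min \<eta>0 (l * \<delta> / 2)"
    have \<eta>: "0 < \<eta>" "\<eta> < \<epsilon> * l / 2" "\<eta> / l < \<delta>"
    proof -
      have "\<eta> \<le> \<eta>0" "\<eta> \<le> l * \<delta> / 2" by (simp_all add: \<eta>_def)
      then show "\<eta> < \<epsilon> * l / 2" using \<eta>0(2) by linarith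
      have "\<eta> < l * \<delta>" using \<open>\<eta> \<le> l * \<delta> / 2\<close> mult_pos_pos[OF l \<delta>] by linarith
      then show "\<eta> / l < \<delta>" using l by (simp add: pos_divide_less_eq mult.commute)
      show "0 < \<eta>" using \<eta>0(1) l \<delta> by (simp add: \<eta>_def)
    qed
    show "\<forall>\<^sub>F r in at_right 0. dist (\<integral>w. \<bar>u r w\<bar> \<partial>M) 0 < \<delta>"
      using small[OF \<eta>(1,2)]
    proof eventually_elim
      case (elim r)
      have "(\<integral>w. \<bar>u r w\<bar> \<partial>M) \<le> \<eta> / l" using conseq[of r "\<eta> / l"] elim \<eta>(1) l by simp
      then show ?case using \<eta>(3) by simp
    qed
  qed
  have ge: "\<forall>\<^sub>F r in at_right 0. integrand_ge M (diff_quotient_integrand f x' x0 r)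
             (\<lambda>w e. - (ereal \<epsilon> * scaled_integrand \<phi> l w e) - ereal (u r w))"
    using ev
  proof eventually_elim
    case (elim r)
    then have "AE w in M. \<bar>excess \<epsilon> l r w\<bar> \<noteq> \<infinity>" by blast
    then show ?case unfolding integrand_ge_def
    proof (rule AE_mp, intro AE_I2 impI allI)
      fix w e assume w: "w \<in> space M" "\<bar>excess \<epsilon> l r w\<bar> \<noteq> \<infinity>"
      have "gap \<epsilon> l r w e \<le> (SUP e. gap \<epsilon> l r w e)" by (rule SUP_upper) simp
      also have "\<dots> \<le> excess \<epsilon> l r w" by (simp add: excess_def)
      also have "\<dots> = ereal (u r w)" using w(2) by (simp add: u_def ereal_real')
      finally have "gap \<epsilon> l r w e \<le> ereal (u r w)" .
      then show "- (ereal \<epsilon> * scaled_integrand \<phi> l w e) - ereal (u r w) \<le> diff_quotient_integrand f x' x0 r w e"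
        using phi_nonneg[OF w(1), of "l *\<^sub>R e"] \<epsilon>
        by (cases "\<phi> w (l *\<^sub>R e)"; cases "diff_quotient_integrand f x' x0 r w e")
           (auto simp: gap_def scaled_integrand_def)
    qed
  qed
  have "\<forall>r>0. \<forall>w\<in>space M. 0 \<le> u r w" by (simp add: u_def excess_def real_of_ereal_pos)
  moreover have "\<forall>\<^sub>F r in at_right 0. integrable M (u r)" using ev by eventually_elim blast
  ultimately show "\<exists>u :: real \<Rightarrow> 'w \<Rightarrow> real.
        (\<forall>r>0. \<forall>w\<in>space M. 0 \<le> u r w) \<and>
        (\<forall>\<^sub>F r in at_right 0. integrable M (u r)) \<and>
        ((\<lambda>r. \<integral>w. \<bar>u r w\<bar> \<partial>M) \<longlongrightarrow> 0) (at_right 0) \<and>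
        (\<forall>\<^sub>F r in at_right 0.
           integrand_ge M (diff_quotient_integrand f x' x0 r)
             (\<lambda>w e. - (ereal \<epsilon> * scaled_integrand \<phi> l w e) - ereal (u r w)))"
    using lim ge by (intro exI[of _ u] conjI)
qed

end

section \<open>Equivalence of the two assertions\<close>

theorem corollary9p5:
  fixes M :: "'w measure"
    and \<phi> f :: "'w \<Rightarrow> 'e::{banach, second_countable_topology} \<Rightarrow> ereal"
    and x0 :: "'w \<Rightarrow> 'e"
    and x' :: "'w \<Rightarrow> ('e \<Rightarrow>\<^sub>L real)"
  assumes "sigma_finite_measure M"
    and "complete_measure M"
    and "measurable_integrand M \<phi>"
    and "young_integrand M \<phi>"
    and "measurable_integrand M f"
    and "x0 \<in> orlicz_space M \<phi>"
    and "\<bar>int_functional M f x0\<bar> \<noteq> \<infinity>"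
    and "x' \<in> dual_orlicz_space M \<phi>"
  shows "(frechet_minorant_condition M \<phi> f x' x0 \<longrightarrow>
            frechet_subderivative M \<phi> (int_functional M f) x' x0) \<and>
         (atomless M \<longrightarrow>
            (frechet_subderivative M \<phi> (int_functional M f) x' x0 \<longleftrightarrow>
             frechet_minorant_condition M \<phi> f x' x0))"
proof -
  interpret frechet_setting M \<phi> f x0 x'
    using assms by (intro frechet_setting.intro young_setting.intro frechet_setting_axioms.intro)
  show ?thesis
    using frechet_subderivative_if_minorant minorant_if_frechet_subderivative by blast
qed

end
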